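(* Let $Z=\ell_1\oplus_2\mathbb{R}$, where $\ell_1$ is the real Banach space of absolutely summable real sequences. Then the closed unit ball $B_Z=\{z\in Z:\|z\|\le 1\}$, with the metric induced by the norm of $Z$, is a plastic metric space; that is, every non-expansive bijection $F\colon B_Z\to B_Z$ is an isometry.
   Context: All Banach spaces are real. The space $\ell_1$ consists of real sequences $x=(x_n)_{n=1}^\infty$ with $\|x\|=\sum_{n=1}^\infty|x_n|<\infty$. The space $\ell_1\oplus_2\mathbb{R}$ is the vector space $\ell_1\times\mathbb{R}$ with the norm $\|(x,b)\|=\sqrt{\|x\|^2+|b|^2}$. A function $F$ between metric spaces is called non-expansive if $d(F(u),F(v))\le d(u,v)$ for all $u,v$, and an isometry if $d(F(u),F(v))=d(u,v)$ for all $u,v$. A metric space $M$ is called plastic if every non-expansive bijection from $M$ onto itself is an isometry. *)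

theory Defs
  imports "HOL-Analysis.Analysis"
begin

(* Sequences are indexed from 0 instead of 1. *)

typedef ell1 = "{x :: nat \<Rightarrow> real. summable (\<lambda>n. \<bar>x n\<bar>)}"
  morphisms seq Abs_ell1
proof
  show "(\<lambda>_. 0) \<in> {x :: nat \<Rightarrow> real. summable (\<lambda>n. \<bar>x n\<bar>)}"
    by simp
qed

setup_lifting type_definition_ell1

lemma summable_abs_seq: "summable (\<lambda>n. \<bar>seq x n\<bar>)"
  using seq [of x] by simp

instantiation ell1 :: real_vector
begin

lift_definition zero_ell1 :: ell1 is "\<lambda>_. 0"
  by simp

lift_definition plus_ell1 :: "ell1 \<Rightarrow> ell1 \<Rightarrow> ell1" is "\<lambda>x y n. x n + y n"
proof -
  fix x y :: "nat \<Rightarrow> real"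
  assume "summable (\<lambda>n. \<bar>x n\<bar>)" "summable (\<lambda>n. \<bar>y n\<bar>)"
  from summable_add [OF this] show "summable (\<lambda>n. \<bar>x n + y n\<bar>)"
    by (rule summable_comparison_test') (simp add: abs_triangle_ineq)
qed

lift_definition uminus_ell1 :: "ell1 \<Rightarrow> ell1" is "\<lambda>x n. - x n"
  by simp

lift_definition minus_ell1 :: "ell1 \<Rightarrow> ell1 \<Rightarrow> ell1" is "\<lambda>x y n. x n - y n"
proof -
  fix x y :: "nat \<Rightarrow> real"
  assume "summable (\<lambda>n. \<bar>x n\<bar>)" "summable (\<lambda>n. \<bar>y n\<bar>)"
  from summable_add [OF this] show "summable (\<lambda>n. \<bar>x n - y n\<bar>)"
    by (rule summable_comparison_test') (simp add: abs_triangle_ineq4)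
qed

lift_definition scaleR_ell1 :: "real \<Rightarrow> ell1 \<Rightarrow> ell1" is "\<lambda>r x n. r * x n"
  by (simp add: abs_mult summable_mult)

instance
  by standard (transfer; simp add: fun_eq_iff algebra_simps)+

end

instantiation ell1 :: real_normed_vector
begin

lift_definition norm_ell1 :: "ell1 \<Rightarrow> real" is "\<lambda>x. \<Sum>n. \<bar>x n\<bar>" .

definition sgn_ell1 :: "ell1 \<Rightarrow> ell1"
  where "sgn_ell1 x = x /\<^sub>R norm x"

definition dist_ell1 :: "ell1 \<Rightarrow> ell1 \<Rightarrow> real"
  where "dist_ell1 x y = norm (x - y)"

definition uniformity_ell1 :: "(ell1 \<times> ell1) filter"
  where "uniformity_ell1 = (INF e\<in>{0<..}. principal {(x, y). dist x y < e})"

definition open_ell1 :: "ell1 set \<Rightarrow> bool"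
  where "open_ell1 U \<longleftrightarrow> (\<forall>x\<in>U. eventually (\<lambda>(x', y). x' = x \<longrightarrow> y \<in> U) uniformity)"

instance
proof
  fix x y :: ell1 and r :: real and U :: "ell1 set"
  show "dist x y = norm (x - y)" by (rule dist_ell1_def)
  show "sgn x = x /\<^sub>R norm x" by (rule sgn_ell1_def)
  show "uniformity = (INF e\<in>{0<..}. principal {(x :: ell1, y). dist x y < e})"
    by (rule uniformity_ell1_def)
  show "open U \<longleftrightarrow> (\<forall>x\<in>U. eventually (\<lambda>(x', y). x' = x \<longrightarrow> y \<in> U) uniformity)"
    by (rule open_ell1_def)
  show "norm x = 0 \<longleftrightarrow> x = 0"
    by transfer (simp add: suminf_eq_zero_iff fun_eq_iff)
  show "norm (r *\<^sub>R x) = \<bar>r\<bar> * norm x"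
    by transfer (simp add: abs_mult suminf_mult)
  show "norm (x + y) \<le> norm x + norm y"
  proof -
    have "(\<Sum>n. \<bar>seq (x + y) n\<bar>) \<le> (\<Sum>n. \<bar>seq x n\<bar> + \<bar>seq y n\<bar>)"
      by (rule suminf_le)
        (auto simp: plus_ell1.rep_eq abs_triangle_ineq
          intro: summable_abs_seq summable_add summable_abs_seq [of "x + y", unfolded plus_ell1.rep_eq])
    also have "\<dots> = (\<Sum>n. \<bar>seq x n\<bar>) + (\<Sum>n. \<bar>seq y n\<bar>)"
      by (simp add: suminf_add summable_abs_seq)
    finally show ?thesis by (simp add: norm_ell1.rep_eq)
  qed
qed

end

definition nonexpansive_on :: "'a::metric_space set \<Rightarrow> ('a \<Rightarrow> 'b::metric_space) \<Rightarrow> bool"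
  where "nonexpansive_on M F \<longleftrightarrow> (\<forall>u\<in>M. \<forall>v\<in>M. dist (F u) (F v) \<le> dist u v)"

definition isometry_on :: "'a::metric_space set \<Rightarrow> ('a \<Rightarrow> 'b::metric_space) \<Rightarrow> bool"
  where "isometry_on M F \<longleftrightarrow> (\<forall>u\<in>M. \<forall>v\<in>M. dist (F u) (F v) = dist u v)"

definition plastic :: "'a::metric_space set \<Rightarrow> bool"
  where "plastic M \<longleftrightarrow> (\<forall>F. bij_betw F M M \<and> nonexpansive_on M F \<longrightarrow> isometry_on M F)"

(* The library norm on a product type is the Euclidean combination of the two norms
   (norm_Pair), so this type carries the norm of the 2-sum of ell1 and the reals. *)
type_synonym ell1_sum2_real = "ell1 \<times> real"

end

theory Submission
  imports Defs
begin

text \<open>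
  Let \<open>G\<close> be the inverse of a non-expansive bijection \<open>F\<close> of the unit ball; it expands distances,
  is odd on extreme points and maps extreme points to extreme points. Here the extreme points form
  countably many Euclidean circles \<open>C\<^sub>n\<close>, the unit circles of the planes spanned by \<open>e\<^sub>n\<close> and the pole
  \<open>N = (0, 1)\<close>. Two extreme points \<open>u\<close>, \<open>v\<close> lie in a common circle iff
  \<open>\<parallel>u - v\<parallel>\<^sup>2 + \<parallel>u + v\<parallel>\<^sup>2 = 4\<close>, the left-hand side being at least 4 in general; so if \<open>G u\<close> and
  \<open>G v\<close> lie in a common circle, then so do \<open>u\<close> and \<open>v\<close>, at the same distance. By uncountability
  two independent points of \<open>C\<^sub>n\<close> are mapped into one circle, and uniqueness of metric betweenness in a
  Euclidean plane makes \<open>G\<close> linear on all of \<open>C\<^sub>n\<close>. Hence \<open>G e\<^sub>n\<close> is \<open>\<plusminus>\<close> the unit vector with index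
  \<open>\<sigma> n\<close> for an injective \<open>\<sigma>\<close>, and \<open>G N = \<plusminus>N\<close>.

  Let \<open>J\<close> be the linear isometric embedding extending these values and \<open>H = F \<circ> J\<close>, which is the identity
  on each of the planes. On a horizontal slice \<open>H\<close> can move a point \<open>a f + b g\<close> with two nonzero
  coordinates only to \<open>(a - d) f + (b - d) g\<close>. The image of such points contains a neighbourhood of 0,
  and for \<open>y\<close> in the sphere the points \<open>F (\<tau> G y)\<close> lie metrically between 0 and \<open>y\<close>; for small
  \<open>\<tau>\<close> injectivity puts \<open>G y\<close> into the range of \<open>J\<close> and comparing norms gives \<open>d = 0\<close>. With at least
  three nonzero coordinates betweenness alone forces \<open>H x = x\<close> by induction. By density \<open>F \<circ> J\<close> is the
  identity, so \<open>J \<circ> F\<close> is as well and \<open>F\<close> preserves distances.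
\<close>

section \<open>Non-expansive bijections of a unit ball\<close>

definition ball_extreme :: "'a::real_normed_vector \<Rightarrow> bool"
  where "ball_extreme e \<longleftrightarrow> norm e \<le> 1 \<and> (\<forall>w. norm (e + w) \<le> 1 \<and> norm (e - w) \<le> 1 \<longrightarrow> w = 0)"

text \<open>Write \<open>w = r (t e + h)\<close>. The bounds put \<open>t e + h\<close> in the ball
  of radius \<open>t\<close> and \<open>(1 - t) e - h\<close> in that of radius
  \<open>1 - t\<close>; adding the complementary multiples of \<open>e\<close> puts
  \<open>e + h\<close> and \<open>e - h\<close> in the unit ball, so \<open>h = 0\<close>.\<close>

lemma ball_extreme_between:
  assumes e: "ball_extreme e" and r: "0 < r" and t: "0 \<le> t" "t \<le> 1"
    and w: "norm w \<le> t * r" "norm (r *\<^sub>R e - w) \<le> (1 - t) * r"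
  shows "w = (t * r) *\<^sub>R e"
proof -
  define h where "h = (1 / r) *\<^sub>R w - t *\<^sub>R e"
  have e1: "norm e \<le> 1" using e by (simp add: ball_extreme_def)
  have 1: "norm (t *\<^sub>R e + h) \<le> t"
    using w(1) r by (simp add: h_def field_simps)
  have "(1 - t) *\<^sub>R e - h = (1 / r) *\<^sub>R (r *\<^sub>R e - w)"
    using r by (simp add: h_def algebra_simps)
  then have "norm ((1 - t) *\<^sub>R e - h) = norm (r *\<^sub>R e - w) / r"
    using r by (simp only: norm_scaleR) simp
  then have 2: "norm ((1 - t) *\<^sub>R e - h) \<le> 1 - t"
    using w(2) r by (simp add: pos_divide_le_eq)
  have "norm (e + h) \<le> norm ((1 - t) *\<^sub>R e) + norm (t *\<^sub>R e + h)"
    using norm_triangle_ineq[of "(1 - t) *\<^sub>R e" "t *\<^sub>R e + h"] by (simp add: algebra_simps)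
  also have "\<dots> \<le> (1 - t) * 1 + t"
    using 1 t e1 by (intro add_mono) (auto intro: mult_left_mono simp: mult_left_le)
  finally have a: "norm (e + h) \<le> 1" by simp
  have "norm (e - h) = norm (t *\<^sub>R e + ((1 - t) *\<^sub>R e - h))"
    by (simp add: algebra_simps)
  also have "\<dots> \<le> norm (t *\<^sub>R e) + norm ((1 - t) *\<^sub>R e - h)"
    by (rule norm_triangle_ineq)
  also have "\<dots> \<le> t * 1 + (1 - t)"
    using 2 t e1 by (intro add_mono) (auto intro: mult_left_mono simp: mult_left_le)
  finally have b: "norm (e - h) \<le> 1" by simp
  have "h = 0" using e a b by (auto simp: ball_extreme_def)
  then have "w = r *\<^sub>R (t *\<^sub>R e)" using r
    by (metis h_def eq_iff_diff_eq_0 divideR_right scaleR_one divide_inverse inverse_eq_divide less_irrefl)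
  then show ?thesis by (simp add: mult.commute)
qed

locale nonexpansive_ball_bijection =
  fixes F :: "'a::real_normed_vector \<Rightarrow> 'a"
  assumes bij: "bij_betw F (cball 0 1) (cball 0 1)"
    and nonexpansive: "nonexpansive_on (cball 0 1) F"
begin

definition G :: "'a \<Rightarrow> 'a" where "G = inv_into (cball 0 1) F"

lemma norm_F_le_1: "norm x \<le> 1 \<Longrightarrow> norm (F x) \<le> 1"
  using bij_betwE[OF bij] by simp

lemma F_le: "norm x \<le> 1 \<Longrightarrow> norm y \<le> 1 \<Longrightarrow> norm (F x - F y) \<le> norm (x - y)"
  using nonexpansive by (simp add: nonexpansive_on_def dist_norm)

lemma F_inj: "norm x \<le> 1 \<Longrightarrow> norm y \<le> 1 \<Longrightarrow> F x = F y \<Longrightarrow> x = y"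
  using bij_betw_imp_inj_on[OF bij] by (simp add: inj_on_def)

lemma norm_G_le_1: "norm y \<le> 1 \<Longrightarrow> norm (G y) \<le> 1"
  using bij_betwE[OF bij_betw_inv_into[OF bij]] by (simp add: G_def)

lemma F_G: "norm y \<le> 1 \<Longrightarrow> F (G y) = y"
  using bij_betw_inv_into_right[OF bij] by (simp add: G_def)

lemma G_ge: "norm x \<le> 1 \<Longrightarrow> norm y \<le> 1 \<Longrightarrow> norm (x - y) \<le> norm (G x - G y)"
  using F_le[of "G x" "G y"] by (simp add: F_G norm_G_le_1)

text \<open>\<^term>\<open>F 0\<close> is at distance at most 1 from every point of the ball, and only the centre is.\<close>

lemma F_0: "F 0 = 0"
proof (rule ccontr)
  assume p: "F 0 \<noteq> 0"
  define y where "y = - (1 / norm (F 0)) *\<^sub>R F 0"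
  have y: "norm y \<le> 1" using p by (simp add: y_def)
  have "F 0 - y = (1 + 1 / norm (F 0)) *\<^sub>R F 0"
    by (simp add: y_def algebra_simps)
  then have "norm (F 0 - y) = (1 + 1 / norm (F 0)) * norm (F 0)" by simp
  also have "\<dots> = norm (F 0) + 1" using p by (simp add: field_simps)
  finally have "norm (F 0 - y) > 1" using p by simp
  moreover have "norm (F 0 - F (G y)) \<le> norm (0 - G y)"
    using y by (intro F_le) (auto simp: norm_G_le_1)
  ultimately show False using y norm_G_le_1[OF y] by (simp add: F_G)
qed

lemma norm_F_le: "norm x \<le> 1 \<Longrightarrow> norm (F x) \<le> norm x"
  using F_le[of x 0] by (simp add: F_0)

lemma norm_G_sphere: "norm y = 1 \<Longrightarrow> norm (G y) = 1"
  using norm_F_le[of "G y"] norm_G_le_1[of y] by (simp add: F_G)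

text \<open>The only metric midpoint of \<open>e\<close> and \<open>- e\<close> is 0, so by injectivity the same
  holds for their preimages.\<close>

lemma F_midpoint:
  assumes e: "ball_extreme e" and z: "norm z \<le> 1" "norm (z - G e) \<le> 1" "norm (z - G (- e)) \<le> 1"
  shows "z = 0"
proof -
  have e1: "norm e \<le> 1" using e by (simp add: ball_extreme_def)
  have "norm (F z - e) \<le> 1" "norm (F z - (- e)) \<le> 1"
    using F_le[OF z(1) norm_G_le_1[OF e1]] F_le[OF z(1) norm_G_le_1[of "- e"]] z e1
    by (simp_all add: F_G)
  then have "norm (e + F z) \<le> 1" "norm (e - F z) \<le> 1"
    by (simp_all add: norm_minus_commute add.commute)
  then have "F z = F 0" using e by (simp add: ball_extreme_def F_0)
  then show ?thesis using z(1) by (auto intro: F_inj)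
qed

text \<open>The midpoint of \<open>G e\<close> and \<open>G (- e)\<close> is within distance 1 of
  both, so \<open>F_midpoint\<close> makes it 0.\<close>

lemma G_uminus:
  assumes e: "ball_extreme e" shows "G (- e) = - G e"
proof -
  have e1: "norm e \<le> 1" using e by (simp add: ball_extreme_def)
  define z where "z = (1 / 2) *\<^sub>R (G e + G (- e))"
  have n: "norm (G e) \<le> 1" "norm (G (- e)) \<le> 1" using e1 by (simp_all add: norm_G_le_1)
  have sum: "norm (G e + G (- e)) \<le> 2" and diff: "norm (G e - G (- e)) \<le> 2"
    using norm_triangle_ineq[of "G e" "G (- e)"] norm_triangle_ineq4[of "G e" "G (- e)"] n by linarith+
  have "z - G e = (1 / 2) *\<^sub>R (G (- e) - G e)" "z - G (- e) = (1 / 2) *\<^sub>R (G e - G (- e))"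
    unfolding z_def by (simp_all add: algebra_simps flip: scaleR_left_distrib)
  then have "z = 0"
    using sum diff by (intro F_midpoint[OF e]) (simp_all add: z_def norm_minus_commute)
  then show ?thesis by (simp add: z_def add_eq_0_iff)
qed

text \<open>If \<open>G e + w\<close> and \<open>G e - w\<close> lie in the ball, then
  \<open>w\<close> is within distance 1 of both \<open>G e\<close> and
  \<open>- G e = G (- e)\<close>, so \<open>F_midpoint\<close> applies to \<open>w\<close>
  itself.\<close>

lemma ball_extreme_G:
  assumes e: "ball_extreme e" shows "ball_extreme (G e)"
  unfolding ball_extreme_def
proof (intro conjI allI impI)
  show "norm (G e) \<le> 1" using e by (simp add: ball_extreme_def norm_G_le_1)
next
  fix w assume w: "norm (G e + w) \<le> 1 \<and> norm (G e - w) \<le> 1"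
  have "2 * norm w = norm ((G e + w) - (G e - w))"
    by (simp add: algebra_simps flip: scaleR_2)
  also have "\<dots> \<le> 2" using norm_triangle_ineq4[of "G e + w" "G e - w"] w by linarith
  finally show "w = 0"
    using w by (intro F_midpoint[OF e]) (simp_all add: G_uminus[OF e] norm_minus_commute add.commute)
qed

text \<open>The image has norm at most \<open>t\<close> and distance at most \<open>1 - t\<close>
  from \<open>e = F (G e)\<close>, so \<open>ball_extreme_between\<close> leaves only
  \<open>t e\<close>.\<close>

lemma F_scaleR_G:
  assumes e: "ball_extreme e" and t: "0 \<le> t" "t \<le> 1"
  shows "F (t *\<^sub>R G e) = t *\<^sub>R e"
proof -
  have e1: "norm e \<le> 1" using e by (simp add: ball_extreme_def)
  have n: "norm (G e) \<le> 1" using e1 by (rule norm_G_le_1)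
  have tn: "norm (t *\<^sub>R G e) \<le> t" using n t by (simp add: mult_left_le)
  have "norm (e - F (t *\<^sub>R G e)) \<le> norm (G e - t *\<^sub>R G e)"
    using F_le[OF n, of "t *\<^sub>R G e"] tn t e1 by (simp add: F_G)
  also have "\<dots> = (1 - t) * norm (G e)"
    using t by (metis abs_of_nonneg diff_ge_0_iff_ge norm_scaleR scaleR_diff_left scaleR_one)
  also have "\<dots> \<le> (1 - t) * 1"
    using n t by (intro mult_left_mono) auto
  finally have "norm (e - F (t *\<^sub>R G e)) \<le> 1 - t" by simp
  moreover have "norm (F (t *\<^sub>R G e)) \<le> t"
    using norm_F_le[of "t *\<^sub>R G e"] tn t by linarith
  ultimately show ?thesis
    using ball_extreme_between[OF e, of 1 t] t by simp
qed

text \<open>With \<open>t = a + b\<close> the argument lies on the segment from \<open>t G u\<close>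
  to \<open>t G v\<close>, whose ends go to \<open>t u\<close> and \<open>t v\<close> at the same
  distance. The image is metrically between these two, and extremality of the normalised direction
  \<open>v - u\<close> makes such a point unique.\<close>

lemma F_combination:
  assumes u: "ball_extreme u" and v: "ball_extreme v" and d: "ball_extreme ((1 / norm (u - v)) *\<^sub>R (v - u))"
    and uv: "norm (G u - G v) = norm (u - v)" and ab: "0 \<le> a" "0 \<le> b" "a + b \<le> 1"
  shows "F (a *\<^sub>R G u + b *\<^sub>R G v) = a *\<^sub>R u + b *\<^sub>R v"
proof (cases "u = v \<or> a + b = 0")
  case True
  then show ?thesis
  proof
    assume "u = v"
    then show ?thesis using F_scaleR_G[OF u, of "a + b"] ab by (simp flip: scaleR_left_distrib)
  qed (use ab in \<open>simp add: F_0 add_nonneg_eq_0_iff\<close>)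
next
  case False
  define t where "t = a + b"
  have t: "0 < t" "t \<le> 1" using False ab by (auto simp: t_def)
  define w where "w = F (a *\<^sub>R G u + b *\<^sub>R G v)"
  define r where "r = t * norm (u - v)"
  have r: "r > 0" using False t by (simp add: r_def)
  have nu: "norm (G u) \<le> 1" "norm (G v) \<le> 1" "norm u \<le> 1" "norm v \<le> 1"
    using u v by (simp_all add: ball_extreme_def norm_G_le_1)
  have q: "norm (a *\<^sub>R G u + b *\<^sub>R G v) \<le> 1"
    using norm_triangle_ineq[of "a *\<^sub>R G u" "b *\<^sub>R G v"] ab nu
      mult_left_le[of "norm (G u)" a] mult_left_le[of "norm (G v)" b] by simp
  have tu: "norm (t *\<^sub>R G u) \<le> 1" "norm (t *\<^sub>R G v) \<le> 1"
    using t nu by (simp_all add: mult_le_one)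
  have "norm (w - t *\<^sub>R u) \<le> norm (a *\<^sub>R G u + b *\<^sub>R G v - t *\<^sub>R G u)"
    using F_le[OF q tu(1)] F_scaleR_G[OF u, of t] t by (simp add: w_def)
  also have "a *\<^sub>R G u + b *\<^sub>R G v - t *\<^sub>R G u = b *\<^sub>R (G v - G u)"
    by (simp add: t_def algebra_simps)
  finally have 1: "norm (w - t *\<^sub>R u) \<le> (b / t) * r"
    using ab uv t by (simp add: r_def norm_minus_commute)
  have "norm (t *\<^sub>R v - w) \<le> norm (t *\<^sub>R G v - (a *\<^sub>R G u + b *\<^sub>R G v))"
    using F_le[OF tu(2) q] F_scaleR_G[OF v, of t] t by (simp add: w_def)
  also have "t *\<^sub>R G v - (a *\<^sub>R G u + b *\<^sub>R G v) = a *\<^sub>R (G v - G u)"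
    by (simp add: t_def algebra_simps)
  also have "norm \<dots> = a * norm (u - v)" using ab uv by (simp add: norm_minus_commute)
  also have "\<dots> = (1 - b / t) * r" using t by (simp add: r_def t_def field_simps)
  finally have 2: "norm (t *\<^sub>R v - w) \<le> (1 - b / t) * r" .
  have re: "r *\<^sub>R ((1 / norm (u - v)) *\<^sub>R (v - u)) = t *\<^sub>R (v - u)"
    using False by (simp add: r_def)
  have "w - t *\<^sub>R u = (b / t * r) *\<^sub>R ((1 / norm (u - v)) *\<^sub>R (v - u))"
  proof (rule ball_extreme_between[OF d r])
    show "0 \<le> b / t" "b / t \<le> 1" using ab t by (simp_all add: t_def)
    show "norm (w - t *\<^sub>R u) \<le> b / t * r" by (fact 1)
    show "norm (r *\<^sub>R ((1 / norm (u - v)) *\<^sub>R (v - u)) - (w - t *\<^sub>R u)) \<le> (1 - b / t) * r"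
      unfolding re using 2 by (simp add: algebra_simps)
  qed
  also have "\<dots> = (b / t) *\<^sub>R (t *\<^sub>R (v - u))" by (simp only: re flip: scaleR_scaleR)
  also have "\<dots> = b *\<^sub>R (v - u)" using t by simp
  finally show ?thesis by (simp add: w_def t_def algebra_simps)
qed

end

section \<open>The sequence space\<close>

lemma seq_simps [simp]:
  "seq 0 i = 0" "seq (x + y) i = seq x i + seq y i" "seq (- x) i = - seq x i"
  "seq (x - y) i = seq x i - seq y i" "seq (r *\<^sub>R x) i = r * seq x i"
  by (simp_all add: zero_ell1.rep_eq plus_ell1.rep_eq uminus_ell1.rep_eq minus_ell1.rep_eq scaleR_ell1.rep_eq)

lemma ell1_eqI: "(\<And>i. seq x i = seq y i) \<Longrightarrow> x = y"
  by (simp add: fun_eq_iff flip: seq_inject)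

lift_definition unit :: "nat \<Rightarrow> ell1" is "\<lambda>n i. if i = n then 1 else 0"
  by (rule summable_finite [of "{_}"]) auto

lemma seq_unit [simp]: "seq (unit n) i = (if i = n then 1 else 0)"
  by (simp add: unit.rep_eq)

lemma norm_unit [simp]: "norm (unit n) = 1"
proof -
  have "(\<lambda>i. \<bar>seq (unit n) i\<bar>) sums (\<Sum>i\<in>{n}. \<bar>seq (unit n) i\<bar>)"
    by (rule sums_finite) auto
  then show ?thesis by (simp add: norm_ell1.rep_eq sums_iff)
qed

lemma norm_split: "norm x = \<bar>seq x n\<bar> + norm (x - seq x n *\<^sub>R unit n)"
proof -
  have "(\<lambda>i. if i = n then \<bar>seq x n\<bar> else 0) sums \<bar>seq x n\<bar>"
    using sums_If_finite_set[of "{n}" "\<lambda>i. \<bar>seq x n\<bar>"] by simp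
  moreover have "(\<lambda>i. \<bar>seq (x - seq x n *\<^sub>R unit n) i\<bar>) sums norm (x - seq x n *\<^sub>R unit n)"
    by (simp only: norm_ell1.rep_eq summable_sums summable_abs_seq)
  ultimately have "(\<lambda>i. (if i = n then \<bar>seq x n\<bar> else 0) + \<bar>seq (x - seq x n *\<^sub>R unit n) i\<bar>)
      sums (\<bar>seq x n\<bar> + norm (x - seq x n *\<^sub>R unit n))"
    by (rule sums_add)
  also have "(\<lambda>i. (if i = n then \<bar>seq x n\<bar> else 0) + \<bar>seq (x - seq x n *\<^sub>R unit n) i\<bar>) = (\<lambda>i. \<bar>seq x i\<bar>)"
    by auto
  finally show ?thesis by (simp add: norm_ell1.rep_eq sums_iff)
qed

lemma norm_add_unit: "norm (a *\<^sub>R unit n + x) = \<bar>a + seq x n\<bar> + norm (x - seq x n *\<^sub>R unit n)"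
  using norm_split[of "a *\<^sub>R unit n + x" n] by (simp add: algebra_simps)

lemma abs_seq_le_norm: "\<bar>seq x n\<bar> \<le> norm x"
  using norm_split[of x n] by simp

lemma norm_two_units [simp]: "i \<noteq> j \<Longrightarrow> norm (a *\<^sub>R unit i + b *\<^sub>R unit j) = \<bar>a\<bar> + \<bar>b\<bar>"
  by (simp add: norm_add_unit)

text \<open>The coordinatewise excesses in the triangle inequality are nonnegative and their sum is
  at most 0, so each of them vanishes.\<close>

lemma ell1_between:
  assumes "norm (x - z) + norm (z - y) \<le> norm (x - y)"
  shows "\<bar>seq x i - seq z i\<bar> + \<bar>seq z i - seq y i\<bar> = \<bar>seq x i - seq y i\<bar>"
proof -
  define f where "f = (\<lambda>i. \<bar>seq (x - z) i\<bar> + \<bar>seq (z - y) i\<bar> - \<bar>seq (x - y) i\<bar>)"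
  have "f sums (norm (x - z) + norm (z - y) - norm (x - y))"
    unfolding f_def norm_ell1.rep_eq by (intro sums_diff sums_add summable_sums summable_abs_seq)
  moreover have f0: "f i \<ge> 0" for i by (simp add: f_def)
  ultimately have "suminf f = 0" "summable f"
    using assms suminf_nonneg[of f] by (auto simp: sums_iff)
  then have "f i = 0" using f0 suminf_eq_zero_iff[of f] by simp
  then show ?thesis by (simp add: f_def)
qed

lemma ell1_truncate:
  assumes "e > 0"
  obtains y A where "finite A" "\<And>i. i \<notin> A \<Longrightarrow> seq y i = 0" "\<And>i. i \<in> A \<Longrightarrow> seq y i = seq x i"
    "norm (x - y) < e" "norm y \<le> norm x"
proof -
  obtain k where k: "\<bar>\<Sum>n. \<bar>seq x (n + k)\<bar>\<bar> < e"
    using suminf_exist_split[OF assms summable_abs_seq[of x]] by auto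
  define y where "y = Abs_ell1 (\<lambda>i. if i < k then seq x i else 0)"
  have "summable (\<lambda>n. \<bar>if n < k then seq x n else 0\<bar>)"
    by (rule summable_finite [of "{..<k}"]) auto
  then have y: "seq y i = (if i < k then seq x i else 0)" for i
    by (simp add: y_def Abs_ell1_inverse)
  have "norm (x - y) = (\<Sum>n. \<bar>seq (x - y) (n + k)\<bar>) + (\<Sum>n<k. \<bar>seq (x - y) n\<bar>)"
    unfolding norm_ell1.rep_eq by (rule suminf_split_initial_segment[OF summable_abs_seq])
  then have 1: "norm (x - y) < e" using k by (simp add: y)
  have 2: "norm y \<le> norm x"
    unfolding norm_ell1.rep_eq by (rule suminf_le[OF _ summable_abs_seq summable_abs_seq]) (simp add: y)
  show ?thesis by (rule that[of "{..<k}" y]) (use 1 2 in \<open>simp_all add: y\<close>)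
qed

section \<open>Unordered sums and signed coordinate embeddings\<close>

lemma norm_ell1_infsum: "norm x = (\<Sum>\<^sub>\<infinity>i. \<bar>seq x i\<bar>)" "(\<lambda>i. \<bar>seq x i\<bar>) summable_on UNIV"
proof -
  show s: "(\<lambda>i. \<bar>seq x i\<bar>) summable_on UNIV"
    using summable_abs_seq[of x] by (simp add: summable_on_UNIV_nonneg_real_iff)
  show "norm x = (\<Sum>\<^sub>\<infinity>i. \<bar>seq x i\<bar>)"
    unfolding norm_ell1.rep_eq
    by (rule sums_unique[OF has_sum_imp_sums[OF has_sum_infsum[OF s]], symmetric])
qed

text \<open>\<open>J\<close> puts coordinate \<open>n\<close>, with sign
  \<open>\<epsilon> n\<close>, at place \<open>\<sigma> n\<close> and 0 outside
  \<open>range \<sigma>\<close>. Writing the norm as an unordered sum allows reindexing along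
  \<open>\<sigma>\<close>.\<close>

lemma ell1_signed_embedding:
  assumes \<sigma>: "inj \<sigma>" and \<epsilon>: "\<forall>n. \<bar>\<epsilon> n\<bar> = (1::real)"
  obtains J :: "ell1 \<Rightarrow> ell1" where "\<forall>x y. J (x - y) = J x - J y" "\<forall>r x. J (r *\<^sub>R x) = r *\<^sub>R J x"
    "\<forall>x. norm (J x) = norm x" "\<forall>n. J (unit n) = \<epsilon> n *\<^sub>R unit (\<sigma> n)"
proof -
  define j where "j = (\<lambda>x m. if m \<in> range \<sigma> then \<epsilon> (inv \<sigma> m) * seq x (inv \<sigma> m) else 0)"
  have j\<sigma>: "\<bar>j x (\<sigma> n)\<bar> = \<bar>seq x n\<bar>" for x n
    using \<sigma> \<epsilon> by (simp add: j_def abs_mult)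
  have jo: "j x m = 0" if "m \<notin> range \<sigma>" for x m using that by (simp add: j_def)
  have 1: "(\<lambda>m. \<bar>j x m\<bar>) summable_on range \<sigma>" for x
    using norm_ell1_infsum(2)[of x] by (simp add: summable_on_reindex[OF \<sigma>] o_def j\<sigma>)
  then have 2: "(\<lambda>m. \<bar>j x m\<bar>) summable_on UNIV" for x
    by (rule summable_on_cong_neutral[THEN iffD1, rotated -1]) (auto simp: jo)
  then have s: "summable (\<lambda>m. \<bar>j x m\<bar>)" for x
    by (simp add: summable_on_UNIV_nonneg_real_iff)
  define J where "J = (\<lambda>x. Abs_ell1 (j x))"
  have J: "seq (J x) = j x" for x using s by (simp add: J_def Abs_ell1_inverse)
  show ?thesis
  proof
    show "\<forall>x. norm (J x) = norm x"
    proof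
      fix x
      have "norm (J x) = (\<Sum>\<^sub>\<infinity>m\<in>range \<sigma>. \<bar>j x m\<bar>)"
        unfolding norm_ell1_infsum(1) J by (rule infsum_cong_neutral) (auto simp: jo)
      also have "\<dots> = norm x"
        by (simp add: infsum_reindex[OF \<sigma>] o_def j\<sigma> norm_ell1_infsum(1))
      finally show "norm (J x) = norm x" .
    qed
    show "\<forall>n. J (unit n) = \<epsilon> n *\<^sub>R unit (\<sigma> n)"
      by (intro allI ell1_eqI) (use \<sigma> in \<open>auto simp: J j_def inj_def\<close>)
  qed (intro allI ell1_eqI; simp add: J j_def algebra_simps)+
qed

section \<open>Quadrants of coordinate planes\<close>

text \<open>With \<open>\<bar>s\<bar> = \<bar>t\<bar> = 1\<close> and \<open>a, b \<ge> 0\<close> this parametrises one quadrant of a coordinate plane, so that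
  the four sign patterns are treated at once.\<close>

definition quad :: "nat \<Rightarrow> real \<Rightarrow> nat \<Rightarrow> real \<Rightarrow> real \<Rightarrow> real \<Rightarrow> ell1"
  where "quad i s j t a b = (a * s) *\<^sub>R unit i + (b * t) *\<^sub>R unit j"

lemma quad_swap: "quad i s j t a b = quad j t i s b a"
  by (simp add: quad_def)

lemma quad_diff: "quad i s j t a b - quad i s j t c d = quad i s j t (a - c) (b - d)"
  by (simp add: quad_def algebra_simps)

lemma scaleR_quad: "r *\<^sub>R quad i s j t a b = quad i s j t (r * a) (r * b)"
  by (simp add: quad_def algebra_simps)

lemma quad_0: "quad i s j t 0 0 = 0"
  by (simp add: quad_def)

lemma abs_1_mult_cancel: "\<bar>s::real\<bar> = 1 \<Longrightarrow> s * (s * x) = x"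
  by (metis abs_mult_self_eq mult.assoc mult_1)

lemma norm_quad: "i \<noteq> j \<Longrightarrow> \<bar>s\<bar> = 1 \<Longrightarrow> \<bar>t\<bar> = 1 \<Longrightarrow> norm (quad i s j t a b) = \<bar>a\<bar> + \<bar>b\<bar>"
  by (simp add: quad_def abs_mult)

lemma seq_quad: "i \<noteq> j \<Longrightarrow> seq (quad i s j t a b) k = (if k = i then a * s else if k = j then b * t else 0)"
  by (simp add: quad_def)

lemma seq_quad_snd: "i \<noteq> j \<Longrightarrow> \<bar>t\<bar> = 1 \<Longrightarrow> t * seq (quad i s j t a b) j = b"
  using abs_1_mult_cancel[of t b] by (simp add: seq_quad mult.left_commute)

lemma quad_eq_iff:
  assumes "i \<noteq> j" "\<bar>s\<bar> = 1" "\<bar>t\<bar> = 1"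
  shows "quad i s j t a b = quad i s j t c d \<longleftrightarrow> a = c \<and> b = d"
proof -
  have "quad i s j t a b = quad i s j t c d \<longleftrightarrow> norm (quad i s j t a b - quad i s j t c d) = 0" by simp
  also have "\<dots> \<longleftrightarrow> \<bar>a - c\<bar> + \<bar>b - d\<bar> = 0" unfolding quad_diff by (simp add: norm_quad[OF assms])
  also have "\<dots> \<longleftrightarrow> a = c \<and> b = d" by auto
  finally show ?thesis .
qed

text \<open>Each box condition places one coordinate of \<open>z\<close> between 0 and
  \<open>a * s\<close> or \<open>b * t\<close>; the signs are their own inverses and turn these
  coordinates into the parameters \<open>p\<close> and \<open>q\<close>.\<close>

lemma ell1_between_quad:
  assumes ij: "i \<noteq> j" and st: "\<bar>s\<bar> = 1" "\<bar>t\<bar> = 1"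
    and box: "\<And>k. k \<noteq> i \<Longrightarrow> k \<noteq> j \<Longrightarrow> seq z k = 0"
      "\<bar>a * s - seq z i\<bar> + \<bar>seq z i\<bar> = \<bar>a\<bar>" "\<bar>b * t - seq z j\<bar> + \<bar>seq z j\<bar> = \<bar>b\<bar>"
    and ab: "0 \<le> a" "0 \<le> b"
  obtains p q where "z = quad i s j t p q" "0 \<le> p" "p \<le> a" "0 \<le> q" "q \<le> b"
proof
  show "z = quad i s j t (s * seq z i) (t * seq z j)"
    by (rule ell1_eqI) (use ij st box(1) in \<open>auto simp: seq_quad abs_1_mult_cancel mult.commute\<close>)
  have "s = 1 \<or> s = - 1" "t = 1 \<or> t = - 1" using st by auto
  then show "0 \<le> s * seq z i" "s * seq z i \<le> a" "0 \<le> t * seq z j" "t * seq z j \<le> b"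
    using box(2,3) ab by auto
qed

section \<open>Extreme points\<close>

lemma norm_Pair_le_1: "norm (x, b::real) \<le> 1 \<longleftrightarrow> (norm x)\<^sup>2 + b\<^sup>2 \<le> 1"
  by (simp add: norm_Pair)

lemma norm_Pair_eq_1: "norm (x, b::real) = 1 \<longleftrightarrow> (norm x)\<^sup>2 + b\<^sup>2 = 1"
  by (simp add: norm_Pair)

definition plane_point :: "nat \<Rightarrow> real \<times> real \<Rightarrow> ell1_sum2_real"
  where "plane_point n v = (fst v *\<^sub>R unit n, snd v)"

lemma norm_plane_point [simp]: "norm (plane_point n v) = norm v"
  by (simp add: plane_point_def norm_prod_def)

lemma plane_point_linear:
  "plane_point n (v + w) = plane_point n v + plane_point n w"
  "plane_point n (v - w) = plane_point n v - plane_point n w"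
  "plane_point n (- v) = - plane_point n v"
  "plane_point n (r *\<^sub>R v) = r *\<^sub>R plane_point n v"
  by (simp_all add: plane_point_def algebra_simps)

text \<open>Split \<open>y\<close> into its coordinate \<open>n\<close> and a remainder of norm
  \<open>R\<close>. Adding the two squared norm bounds, the terms in \<open>a\<close> and
  \<open>b\<close> already use up the total of 2, which leaves
  \<open>(seq y n)\<^sup>2 + R\<^sup>2 + c\<^sup>2\<close> at most 0.\<close>

lemma ball_extreme_plane_point:
  assumes "norm v = 1" shows "ball_extreme (plane_point n v)"
  unfolding ball_extreme_def
proof (intro conjI allI impI)
  fix w :: ell1_sum2_real
  obtain y c where w: "w = (y, c)" by (cases w)
  obtain a b where v: "v = (a, b)" by (cases v)
  have ab: "a\<^sup>2 + b\<^sup>2 = 1" using assms by (simp add: v norm_Pair)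
  define R where "R = norm (y - seq y n *\<^sub>R unit n)"
  have R: "R \<ge> 0" by (simp add: R_def)
  assume *: "norm (plane_point n v + w) \<le> 1 \<and> norm (plane_point n v - w) \<le> 1"
  have "norm (a *\<^sub>R unit n + y) = \<bar>a + seq y n\<bar> + R"
    by (simp add: R_def norm_add_unit)
  then have 1: "(\<bar>a + seq y n\<bar> + R)\<^sup>2 + (b + c)\<^sup>2 \<le> 1"
    using conjunct1[OF *] by (simp add: plane_point_def v w norm_Pair_le_1)
  have "norm (a *\<^sub>R unit n + - y) = \<bar>a - seq y n\<bar> + R"
    unfolding norm_add_unit R_def by simp (simp add: norm_minus_commute)
  then have 2: "(\<bar>a - seq y n\<bar> + R)\<^sup>2 + (b - c)\<^sup>2 \<le> 1"
    using conjunct2[OF *] by (simp add: plane_point_def v w norm_Pair_le_1)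
  have "(a + seq y n)\<^sup>2 + R\<^sup>2 \<le> (\<bar>a + seq y n\<bar> + R)\<^sup>2" "(a - seq y n)\<^sup>2 + R\<^sup>2 \<le> (\<bar>a - seq y n\<bar> + R)\<^sup>2"
    using R by (simp_all add: power2_sum)
  then have "(a + seq y n)\<^sup>2 + (a - seq y n)\<^sup>2 + 2 * R\<^sup>2 + (b + c)\<^sup>2 + (b - c)\<^sup>2 \<le> 2"
    using 1 2 by linarith
  then have "2 * (a\<^sup>2 + b\<^sup>2) + 2 * (seq y n)\<^sup>2 + 2 * R\<^sup>2 + 2 * c\<^sup>2 \<le> 2"
    by (simp add: power2_eq_square algebra_simps)
  then have "(seq y n)\<^sup>2 + R\<^sup>2 + c\<^sup>2 \<le> 0" by (simp add: ab)
  then have "seq y n = 0 \<and> R = 0 \<and> c = 0"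
    using zero_le_power2[of "seq y n"] zero_le_power2[of R] zero_le_power2[of c]
    by (metis add_nonneg_nonneg add_nonneg_eq_0_iff antisym power_eq_0_iff)
  then show "w = 0" by (auto simp: w R_def zero_prod_def)
qed (use assms in simp)

lemma ball_extreme_cases:
  assumes e: "ball_extreme e" obtains n v where "e = plane_point n v"
proof -
  obtain x b where xb: "e = (x, b)" by (cases e)
  have eq: "seq x i = 0" if ij: "i \<noteq> j" "seq x j \<noteq> 0" for i j
  proof (rule ccontr)
    assume xi: "seq x i \<noteq> 0"
    define t where "t = min \<bar>seq x i\<bar> \<bar>seq x j\<bar>"
    have t: "0 < t" "t \<le> \<bar>seq x i\<bar>" "t \<le> \<bar>seq x j\<bar>" using xi ij by (auto simp: t_def)
    \<comment> \<open>Adding or subtracting \<open>y\<close> shifts mass \<open>t\<close> between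
      the coordinates \<open>i\<close> and \<open>j\<close>; as \<open>t\<close> exceeds neither
      absolute value, the norm of \<open>x\<close> stays the same in both directions.\<close>
    define y where "y = (t * sgn (seq x i)) *\<^sub>R unit i - (t * sgn (seq x j)) *\<^sub>R unit j"
    have split2: "norm z = \<bar>seq z i\<bar> + \<bar>seq z j\<bar> + norm (z - seq z i *\<^sub>R unit i - seq z j *\<^sub>R unit j)" for z
      using norm_split[of z i] norm_split[of "z - seq z i *\<^sub>R unit i" j] ij(1) by simp
    have "norm (x + y) = norm x"
      unfolding split2[of "x + y"] split2[of x] using ij xi t
      by (simp add: y_def sgn_if algebra_simps)
    moreover have "norm (x - y) = norm x"
      unfolding split2[of "x - y"] split2[of x] using ij xi t
      by (simp add: y_def sgn_if algebra_simps)
    ultimately have "norm (e + (y, 0)) \<le> 1 \<and> norm (e - (y, 0)) \<le> 1"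
      using e by (simp add: xb ball_extreme_def norm_Pair)
    then have "(y, 0::real) = 0" using e unfolding ball_extreme_def by blast
    then have "seq y i = 0" by (simp add: zero_prod_def)
    then show False using ij(1) t xi by (simp add: y_def sgn_if split: if_splits)
  qed
  obtain n where n: "\<And>i. i \<noteq> n \<Longrightarrow> seq x i = 0"
    using eq by metis
  then have "x = seq x n *\<^sub>R unit n" by (intro ell1_eqI) auto
  then show ?thesis by (intro that[of n "(seq x n, b)"]) (simp add: xb plane_point_def)
qed

section \<open>Parallelogram identities for points of the circles\<close>

lemma plane_point_same:
  assumes "norm v = 1" "norm w = 1"
  shows "(norm (plane_point n v - plane_point n w))\<^sup>2 + (norm (plane_point n v + plane_point n w))\<^sup>2 = 4"
  unfolding plane_point_linear(1,2)[symmetric] norm_plane_point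
  using assms by (simp add: power2_norm_eq_inner norm_eq_1 inner_simps inner_commute)

text \<open>With disjoint supports, sum and difference have the same horizontal norm
  \<open>\<bar>a\<bar> + \<bar>c\<bar>\<close>, so the cross terms
  \<open>2 * \<bar>a * c\<bar>\<close> add up instead of cancelling.\<close>

lemma plane_point_different:
  assumes "norm v = 1" "norm w = 1" "n \<noteq> k"
  shows "(norm (plane_point n v - plane_point k w))\<^sup>2 + (norm (plane_point n v + plane_point k w))\<^sup>2
    = 4 + 4 * \<bar>fst v * fst w\<bar>"
proof -
  obtain a b c d where v: "v = (a, b)" "w = (c, d)" by (cases v; cases w)
  have "norm (a *\<^sub>R unit n - c *\<^sub>R unit k) = \<bar>a\<bar> + \<bar>c\<bar>" "norm (a *\<^sub>R unit n + c *\<^sub>R unit k) = \<bar>a\<bar> + \<bar>c\<bar>"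
    using norm_two_units[OF assms(3), of a "- c"] assms(3) by simp_all
  moreover have "a\<^sup>2 + b\<^sup>2 = 1" "c\<^sup>2 + d\<^sup>2 = 1" using assms by (simp_all add: v norm_Pair)
  ultimately show ?thesis
    by (simp add: v plane_point_def norm_Pair) (simp add: power2_eq_square abs_mult algebra_simps)
qed

lemma plane_point_ge:
  assumes "norm v = 1" "norm w = 1"
  shows "4 \<le> (norm (plane_point n v - plane_point k w))\<^sup>2 + (norm (plane_point n v + plane_point k w))\<^sup>2"
  using plane_point_same[OF assms] plane_point_different[OF assms] by (cases "n = k") (auto simp: assms)

section \<open>The inverse on extreme points\<close>

locale ell1_ball_bijection = nonexpansive_ball_bijection F
  for F :: "ell1_sum2_real \<Rightarrow> ell1_sum2_real"
begin

lemma G_plane_point: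
  assumes "norm v = 1"
  obtains k w where "norm w = 1" "G (plane_point n v) = plane_point k w"
proof -
  obtain k w where "G (plane_point n v) = plane_point k w"
    using ball_extreme_cases[OF ball_extreme_G[OF ball_extreme_plane_point[OF assms]]] by metis
  then show ?thesis using that norm_G_sphere[of "plane_point n v"] assms by simp
qed

lemma G_uminus_plane_point: "norm v = 1 \<Longrightarrow> G (- plane_point n v) = - G (plane_point n v)"
  by (rule G_uminus[OF ball_extreme_plane_point])

text \<open>Being expansive and odd, \<open>G\<close> decreases neither the distance nor the norm of
  the sum. For the images the squares add up to 4, the least possible value for the originals, so
  equality holds throughout.\<close>

lemma G_common_plane:
  assumes v: "norm v = 1" "norm v' = 1"
    and G: "G (plane_point n v) = plane_point k w" "G (plane_point m v') = plane_point k w'"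
  shows "norm (G (plane_point n v) - G (plane_point m v')) = norm (plane_point n v - plane_point m v')"
    and "norm (G (plane_point n v) + G (plane_point m v')) = norm (plane_point n v + plane_point m v')"
    and "(norm (plane_point n v - plane_point m v'))\<^sup>2 + (norm (plane_point n v + plane_point m v'))\<^sup>2 = 4"
proof -
  let ?u = "plane_point n v" and ?u' = "plane_point m v'"
  have "norm w = 1" "norm w' = 1"
    using norm_G_sphere[of ?u] norm_G_sphere[of ?u'] v G by simp_all
  then have 4: "(norm (G ?u - G ?u'))\<^sup>2 + (norm (G ?u + G ?u'))\<^sup>2 = 4"
    unfolding G by (rule plane_point_same)
  have a: "norm (?u - ?u') \<le> norm (G ?u - G ?u')" using v by (intro G_ge) simp_all
  have b: "norm (?u + ?u') \<le> norm (G ?u + G ?u')"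
    using G_ge[of ?u "- ?u'"] v by (simp add: G_uminus_plane_point)
  have a': "(norm (?u - ?u'))\<^sup>2 \<le> (norm (G ?u - G ?u'))\<^sup>2" using a by (rule power_mono) simp
  have b': "(norm (?u + ?u'))\<^sup>2 \<le> (norm (G ?u + G ?u'))\<^sup>2" using b by (rule power_mono) simp
  have ge: "4 \<le> (norm (?u - ?u'))\<^sup>2 + (norm (?u + ?u'))\<^sup>2" by (rule plane_point_ge[OF v])
  have "(norm (G ?u - G ?u'))\<^sup>2 = (norm (?u - ?u'))\<^sup>2" "(norm (G ?u + G ?u'))\<^sup>2 = (norm (?u + ?u'))\<^sup>2"
    using a' b' ge 4 by linarith+
  then show "norm (G ?u - G ?u') = norm (?u - ?u')" "norm (G ?u + G ?u') = norm (?u + ?u')"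
    "(norm (?u - ?u'))\<^sup>2 + (norm (?u + ?u'))\<^sup>2 = 4"
    using 4 by simp_all
qed

text \<open>Replacing \<open>v\<close> and \<open>v'\<close> by their negatives where needed makes
  both weights nonnegative, and the factor \<open>t\<close> makes them add up to 1, so
  \<open>F_combination\<close> applies. It gives both sides, scaled by \<open>t\<close>, the same
  image under \<open>F\<close>, and injectivity concludes.\<close>

lemma G_plane_combination:
  assumes v: "norm v = 1" "norm v' = 1" "v \<noteq> v'" "v \<noteq> - v'"
    and G: "G (plane_point n v) = plane_point k w" "G (plane_point n v') = plane_point k w'"
    and e: "norm (\<alpha> *\<^sub>R v + \<beta> *\<^sub>R v') = 1"
  shows "G (plane_point n (\<alpha> *\<^sub>R v + \<beta> *\<^sub>R v')) = \<alpha> *\<^sub>R G (plane_point n v) + \<beta> *\<^sub>R G (plane_point n v')"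
proof -
  define c d where "c = (if \<alpha> \<ge> 0 then 1 else - 1 :: real)" and "d = (if \<beta> \<ge> 0 then 1 else - 1 :: real)"
  define t where "t = 1 / (\<bar>\<alpha>\<bar> + \<bar>\<beta>\<bar>)"
  let ?u = "plane_point n v" and ?u' = "plane_point n v'" and ?e = "plane_point n (\<alpha> *\<^sub>R v + \<beta> *\<^sub>R v')"
  have ge: "1 \<le> \<bar>\<alpha>\<bar> + \<bar>\<beta>\<bar>"
    using norm_triangle_ineq[of "\<alpha> *\<^sub>R v" "\<beta> *\<^sub>R v'"] e v by simp
  then have t: "0 < t" "t \<le> 1" by (auto simp: t_def)
  have cd: "c * \<bar>\<alpha>\<bar> = \<alpha>" "d * \<bar>\<beta>\<bar> = \<beta>" "\<bar>c\<bar> = 1" "\<bar>d\<bar> = 1" by (auto simp: c_def d_def)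
  have nG: "norm (G ?u) = 1" "norm (G ?u') = 1" using v by (simp_all add: norm_G_sphere)
  have Gc: "G (plane_point n (c *\<^sub>R v)) = c *\<^sub>R G ?u" "G (plane_point n (d *\<^sub>R v')) = d *\<^sub>R G ?u'"
    using v by (auto simp: c_def d_def plane_point_linear G_uminus_plane_point)
  have ne: "c *\<^sub>R v \<noteq> d *\<^sub>R v'" using v(3,4) by (auto simp: c_def d_def minus_equation_iff[of v])
  have iso: "norm (c *\<^sub>R G ?u - d *\<^sub>R G ?u') = norm (c *\<^sub>R ?u - d *\<^sub>R ?u')"
    using G_common_plane(1,2)[OF v(1,2) G]
    by (auto simp: c_def d_def norm_minus_commute add.commute simp flip: minus_add_distrib)
  have "F ((t * \<bar>\<alpha>\<bar>) *\<^sub>R G (plane_point n (c *\<^sub>R v)) + (t * \<bar>\<beta>\<bar>) *\<^sub>R G (plane_point n (d *\<^sub>R v')))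
      = (t * \<bar>\<alpha>\<bar>) *\<^sub>R plane_point n (c *\<^sub>R v) + (t * \<bar>\<beta>\<bar>) *\<^sub>R plane_point n (d *\<^sub>R v')"
  proof (rule F_combination)
    show "ball_extreme ((1 / norm (plane_point n (c *\<^sub>R v) - plane_point n (d *\<^sub>R v'))) *\<^sub>R
      (plane_point n (d *\<^sub>R v') - plane_point n (c *\<^sub>R v)))"
      unfolding plane_point_linear(2)[symmetric] plane_point_linear(4)[symmetric] norm_plane_point
      by (rule ball_extreme_plane_point) (use ne in \<open>simp add: norm_minus_commute\<close>)
    show "norm (G (plane_point n (c *\<^sub>R v)) - G (plane_point n (d *\<^sub>R v'))) =
      norm (plane_point n (c *\<^sub>R v) - plane_point n (d *\<^sub>R v'))"
      using iso unfolding Gc by (simp only: plane_point_linear)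
    show "t * \<bar>\<alpha>\<bar> + t * \<bar>\<beta>\<bar> \<le> 1" using ge by (simp add: t_def flip: add_divide_distrib)
  qed (use t v cd in \<open>auto intro!: ball_extreme_plane_point\<close>)
  also have "\<dots> = (t * (c * \<bar>\<alpha>\<bar>)) *\<^sub>R ?u + (t * (d * \<bar>\<beta>\<bar>)) *\<^sub>R ?u'"
    by (simp add: plane_point_linear mult_ac)
  also have "\<dots> = t *\<^sub>R ?e" unfolding cd by (simp add: plane_point_linear algebra_simps)
  also have "\<dots> = F (t *\<^sub>R G ?e)"
    using F_scaleR_G[OF ball_extreme_plane_point[OF e]] t by simp
  also have "(t * \<bar>\<alpha>\<bar>) *\<^sub>R G (plane_point n (c *\<^sub>R v)) + (t * \<bar>\<beta>\<bar>) *\<^sub>R G (plane_point n (d *\<^sub>R v'))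
      = (t * (c * \<bar>\<alpha>\<bar>)) *\<^sub>R G ?u + (t * (d * \<bar>\<beta>\<bar>)) *\<^sub>R G ?u'"
    by (simp add: Gc mult_ac)
  also have "\<dots> = t *\<^sub>R (\<alpha> *\<^sub>R G ?u + \<beta> *\<^sub>R G ?u')" unfolding cd by (simp add: algebra_simps)
  finally have F: "F (t *\<^sub>R (\<alpha> *\<^sub>R G ?u + \<beta> *\<^sub>R G ?u')) = F (t *\<^sub>R G ?e)" .
  have "norm (\<alpha> *\<^sub>R G ?u + \<beta> *\<^sub>R G ?u') \<le> \<bar>\<alpha>\<bar> + \<bar>\<beta>\<bar>"
    using norm_triangle_ineq[of "\<alpha> *\<^sub>R G ?u" "\<beta> *\<^sub>R G ?u'"] nG by simp
  then have 1: "norm (t *\<^sub>R (\<alpha> *\<^sub>R G ?u + \<beta> *\<^sub>R G ?u')) \<le> 1"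
    unfolding norm_scaleR using ge by (simp add: t_def)
  have 2: "norm (t *\<^sub>R G ?e) \<le> 1" using t e norm_G_sphere[of ?e] by simp
  show ?thesis using F_inj[OF 1 2 F] t by simp
qed

text \<open>Each point of a circle is mapped into one of countably many circles, so two linearly
  independent points are mapped into the same one.\<close>

lemma G_plane_pigeonhole:
  obtains v v' k w w' where "norm v = 1" "norm v' = 1" "fst v * snd v' \<noteq> snd v * fst v'"
    "G (plane_point n v) = plane_point k w" "G (plane_point n v') = plane_point k w'"
proof -
  define p where "p = (\<lambda>\<phi>::real. (cos \<phi>, sin \<phi>))"
  have p: "norm (p \<phi>) = 1" for \<phi> by (simp add: p_def norm_Pair)
  have "\<exists>k w. G (plane_point n (p \<phi>)) = plane_point k w" for \<phi>
    using G_plane_point[OF p] by metis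
  then obtain \<kappa> \<omega> where \<kappa>: "\<And>\<phi>. G (plane_point n (p \<phi>)) = plane_point (\<kappa> \<phi>) (\<omega> \<phi>)" by metis
  have "\<not> inj_on \<kappa> {0..1}"
    using uncountable_closed_interval[of 0 1] countableI[of \<kappa> "{0..1}"] by auto
  then obtain \<phi> \<psi> where *: "\<phi> \<in> {0..1}" "\<psi> \<in> {0..1}" "\<phi> \<noteq> \<psi>" "\<kappa> \<phi> = \<kappa> \<psi>"
    by (auto simp: inj_on_def)
  \<comment> \<open>The interval of angles is shorter than \<open>pi\<close>, so distinct angles
    give linearly independent directions.\<close>
  have "sin (\<psi> - \<phi>) \<noteq> 0"
  proof
    assume "sin (\<psi> - \<phi>) = 0"
    moreover have "\<bar>\<psi> - \<phi>\<bar> < pi" using * pi_gt3 by auto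
    ultimately have "\<psi> - \<phi> = 0" using sin_eq_0_pi[of "\<psi> - \<phi>"] by linarith
    then show False using * by simp
  qed
  then have "fst (p \<phi>) * snd (p \<psi>) \<noteq> snd (p \<phi>) * fst (p \<psi>)"
    by (simp add: p_def sin_diff mult.commute)
  then show ?thesis using that[OF p p _ \<kappa>[of \<phi>]] \<kappa>[of \<psi>] * by simp
qed

lemma G_plane_linear:
  obtains k w w' where "G (plane_point n (1, 0)) = plane_point k w" "G (plane_point n (0, 1)) = plane_point k w'"
    "\<And>a b. a\<^sup>2 + b\<^sup>2 = 1 \<Longrightarrow> G (plane_point n (a, b)) = a *\<^sub>R G (plane_point n (1, 0)) + b *\<^sub>R G (plane_point n (0, 1))"
proof -
  obtain v v' k w w' where v: "norm v = 1" "norm v' = 1" "fst v * snd v' \<noteq> snd v * fst v'"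
    and G: "G (plane_point n v) = plane_point k w" "G (plane_point n v') = plane_point k w'"
    by (rule G_plane_pigeonhole)
  obtain p q p' q' where pq: "v = (p, q)" "v' = (p', q')" by (cases v; cases v')
  define D where "D = p * q' - q * p'"
  have D: "D \<noteq> 0" using v by (simp add: D_def pq)
  have ne: "v \<noteq> v'" "v \<noteq> - v'" using v(3) by auto
  \<comment> \<open>Cramer's rule in the basis \<open>v\<close>, \<open>v'\<close> with determinant
    \<open>D\<close>.\<close>
  have comb: "(a, b) = ((a * q' - b * p') / D) *\<^sub>R v + ((p * b - q * a) / D) *\<^sub>R v'" for a b
  proof -
    have "(a * q' - b * p') * p + (p * b - q * a) * p' = a * D"
      "(a * q' - b * p') * q + (p * b - q * a) * q' = b * D"
      by (simp_all add: D_def algebra_simps)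
    then show ?thesis using D by (simp add: pq add_divide_distrib[symmetric])
  qed
  have G': "G (plane_point n (a, b)) = ((a * q' - b * p') / D) *\<^sub>R plane_point k w + ((p * b - q * a) / D) *\<^sub>R plane_point k w'"
    if "a\<^sup>2 + b\<^sup>2 = 1" for a b
  proof -
    have "norm (((a * q' - b * p') / D) *\<^sub>R v + ((p * b - q * a) / D) *\<^sub>R v') = 1"
      unfolding comb[symmetric] using that by (simp add: norm_Pair)
    from G_plane_combination[OF v(1,2) ne G this] show ?thesis unfolding comb[symmetric] G .
  qed
  have axes: "G (plane_point n (1, 0)) = (q' / D) *\<^sub>R plane_point k w + (- q / D) *\<^sub>R plane_point k w'"
    "G (plane_point n (0, 1)) = (- p' / D) *\<^sub>R plane_point k w + (p / D) *\<^sub>R plane_point k w'"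
    using G'[of 1 0] G'[of 0 1] by simp_all
  show ?thesis
  proof
    show "G (plane_point n (1, 0)) = plane_point k ((q' / D) *\<^sub>R w + (- q / D) *\<^sub>R w')"
      "G (plane_point n (0, 1)) = plane_point k ((- p' / D) *\<^sub>R w + (p / D) *\<^sub>R w')"
      by (simp_all only: axes plane_point_linear)
  next
    fix a b :: real assume ab: "a\<^sup>2 + b\<^sup>2 = 1"
    have "(a * q' - b * p') / D = a * (q' / D) + b * (- p' / D)" "(p * b - q * a) / D = a * (- q / D) + b * (p / D)"
      using D by (simp_all add: field_simps)
    then show "G (plane_point n (a, b)) = a *\<^sub>R G (plane_point n (1, 0)) + b *\<^sub>R G (plane_point n (0, 1))"
      unfolding G'[OF ab] axes by (simp only: scaleR_add_left scaleR_add_right scaleR_scaleR ac_simps)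
  qed
qed

text \<open>The pole lies on every circle, so its image lies in the planes of several different
  indices and must be vertical. Preserved distances to the pole then make the image of each
  \<open>unit n\<close> horizontal, and \<open>F_scaleR_G\<close> extends the description from the
  circles to the discs.\<close>

lemma G_axes:
  obtains \<sigma> \<epsilon> s where "inj \<sigma>" "\<forall>n. \<bar>\<epsilon> n\<bar> = 1" "\<bar>s\<bar> = 1"
    "\<forall>n a b. a\<^sup>2 + b\<^sup>2 \<le> 1 \<longrightarrow> F (a *\<^sub>R \<epsilon> n *\<^sub>R unit (\<sigma> n), b * s) = (a *\<^sub>R unit n, b)"
proof -
  let ?N = "(0, 1) :: ell1_sum2_real" and ?e = "\<lambda>n. (unit n, 0) :: ell1_sum2_real"
  have eN: "plane_point n (1, 0) = ?e n" "plane_point n (0, 1) = ?N" for n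
    by (simp_all add: plane_point_def)
  have "\<exists>k w w'. G (?e n) = plane_point k w \<and> G ?N = plane_point k w' \<and>
      (\<forall>a b. a\<^sup>2 + b\<^sup>2 = 1 \<longrightarrow> G (plane_point n (a, b)) = a *\<^sub>R G (?e n) + b *\<^sub>R G ?N)" for n
    using G_plane_linear[of n] unfolding eN by metis
  then obtain \<sigma> w w' where Ge: "\<And>n. G (?e n) = plane_point (\<sigma> n) (w n)"
    and GN: "\<And>n. G ?N = plane_point (\<sigma> n) (w' n)"
    and G: "\<And>n a b. a\<^sup>2 + b\<^sup>2 = 1 \<Longrightarrow> G (plane_point n (a, b)) = a *\<^sub>R G (?e n) + b *\<^sub>R G ?N"
    by metis
  have inj: "inj \<sigma>"
  proof (rule injI, rule ccontr)
    fix n m assume *: "\<sigma> n = \<sigma> m" "n \<noteq> m"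
    \<comment> \<open>Equal indices would force the value 4, whereas
      \<open>plane_point_different\<close> gives 8 here.\<close>
    have "(norm (plane_point n (1, 0) - plane_point m (1, 0)))\<^sup>2 + (norm (plane_point n (1, 0) + plane_point m (1, 0)))\<^sup>2 = 4"
      by (rule G_common_plane(3)[of _ _ _ "\<sigma> n" "w n" _ "w m"]) (simp_all add: eN Ge *(1) norm_Pair)
    then show False using plane_point_different[of "(1, 0)" "(1, 0)" n m] *(2) by (simp add: norm_Pair)
  qed
  then have "\<sigma> 0 \<noteq> \<sigma> 1" by (simp add: inj_eq)
  moreover have "fst (w' 0) *\<^sub>R unit (\<sigma> 0) = fst (w' 1) *\<^sub>R unit (\<sigma> 1)"
    using GN[of 0] GN[of 1] by (simp add: plane_point_def)
  then have "seq (fst (w' 0) *\<^sub>R unit (\<sigma> 0)) (\<sigma> 0) = seq (fst (w' 1) *\<^sub>R unit (\<sigma> 1)) (\<sigma> 0)" by simp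
  ultimately have "fst (w' 0) = 0" by (simp split: if_splits)
  then obtain s where s: "G ?N = (0, s)" using GN[of 0] by (simp add: plane_point_def)
  have s1: "\<bar>s\<bar> = 1" using norm_G_sphere[of ?N] by (simp add: s norm_Pair)
  \<comment> \<open>The images are unit vectors of one Euclidean plane at squared distance 2, hence
    orthogonal, and one of them is vertical.\<close>
  have "snd (w n) = 0" for n
  proof -
    have "norm (G (plane_point n (1, 0)) - G (plane_point n (0, 1))) = norm (plane_point n (1, 0) - plane_point n (0, 1))"
      by (rule G_common_plane(1)[of _ _ _ "\<sigma> n" "w n" _ "w' n"]) (simp_all add: eN Ge GN[of n] norm_Pair)
    then have "norm (fst (w n) *\<^sub>R unit (\<sigma> n), snd (w n) - s) = norm (unit n, - 1 :: real)"
      by (simp add: eN s) (simp add: Ge plane_point_def)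
    then have "(fst (w n))\<^sup>2 + (snd (w n) - s)\<^sup>2 = 2" by (simp add: norm_Pair)
    moreover have "(fst (w n))\<^sup>2 + (snd (w n))\<^sup>2 = 1"
      using norm_G_sphere[of "?e n"] by (simp add: Ge plane_point_def norm_Pair)
    moreover have "s\<^sup>2 = 1" using s1 by (metis power2_abs one_power2)
    ultimately have "2 * (snd (w n) * s) = 0" unfolding power2_diff by linarith
    then show ?thesis using s1 by auto
  qed
  then have Ge': "G (?e n) = (fst (w n) *\<^sub>R unit (\<sigma> n), 0)" for n
    by (simp add: Ge plane_point_def)
  have \<epsilon>: "\<bar>fst (w n)\<bar> = 1" for n using norm_G_sphere[of "?e n"] by (simp add: Ge' norm_Pair)
  have F: "F (a *\<^sub>R fst (w n) *\<^sub>R unit (\<sigma> n), b * s) = (a *\<^sub>R unit n, b)" if "a\<^sup>2 + b\<^sup>2 \<le> 1" for n a b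
  proof (cases "a = 0 \<and> b = 0")
    case True then show ?thesis using F_0 by (simp add: zero_prod_def)
  next
    case False
    define t where "t = sqrt (a\<^sup>2 + b\<^sup>2)"
    have t: "0 < t" "t \<le> 1" "t\<^sup>2 = a\<^sup>2 + b\<^sup>2" using False that by (auto simp: t_def sum_power2_gt_zero_iff)
    have 1: "(a / t)\<^sup>2 + (b / t)\<^sup>2 = 1" using t
      by (metis add_divide_distrib divide_self_if less_irrefl power_divide zero_eq_power2)
    then have "norm (a / t, b / t) = 1" unfolding norm_Pair real_norm_def power2_abs by simp
    then have e: "ball_extreme (plane_point n (a / t, b / t))" by (rule ball_extreme_plane_point)
    have "F (t *\<^sub>R G (plane_point n (a / t, b / t))) = t *\<^sub>R plane_point n (a / t, b / t)"
      using F_scaleR_G[OF e] t by simp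
    then show ?thesis unfolding G[OF 1] Ge' s using t by (simp add: plane_point_def)
  qed
  show ?thesis by (rule that[of \<sigma> "\<lambda>n. fst (w n)" s]) (simp_all add: inj \<epsilon> s1 F del: scaleR_scaleR)
qed

end

section \<open>Identity on the ball\<close>

text \<open>Here \<open>J\<close> is an isometric linear model of \<open>G\<close>, matched with it
  on each plane spanned by a unit vector and the pole. That \<open>J\<close> reaches the whole ball
  only comes out at the end, from \<open>H_id\<close> and injectivity of \<open>F\<close>.\<close>

locale normalized_ell1_ball_bijection = ell1_ball_bijection F
  for F :: "ell1_sum2_real \<Rightarrow> ell1_sum2_real" +
  fixes J :: "ell1_sum2_real \<Rightarrow> ell1_sum2_real"
  assumes J_diff: "J (x - y) = J x - J y" and J_scaleR: "J (r *\<^sub>R x) = r *\<^sub>R J x"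
    and norm_J: "norm (J x) = norm x"
    and F_J_axis: "a\<^sup>2 + b\<^sup>2 \<le> 1 \<Longrightarrow> F (J (a *\<^sub>R unit n, b)) = (a *\<^sub>R unit n, b)"
begin

definition H :: "ell1_sum2_real \<Rightarrow> ell1_sum2_real" where "H z = F (J z)"

lemma H_le: "norm x \<le> 1 \<Longrightarrow> norm y \<le> 1 \<Longrightarrow> norm (H x - H y) \<le> norm (x - y)"
  unfolding H_def using F_le[of "J x" "J y"] by (simp add: norm_J flip: J_diff)

lemma H_0: "H 0 = 0"
  using F_J_axis[of 0 0] by (simp add: H_def flip: zero_prod_def)

lemma H_inj: assumes "norm x \<le> 1" "norm y \<le> 1" "H x = H y" shows "x = y"
proof -
  have "J x = J y" using F_inj[of "J x" "J y"] assms by (simp add: H_def norm_J)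
  then show ?thesis using norm_J[of "x - y"] by (simp add: J_diff)
qed

text \<open>The image is at distance at most \<open>norm y\<close> from \<open>(x, \<beta>)\<close>
  and \<open>norm x\<close> from \<open>(y, \<beta>)\<close>. These bounds add up to
  \<open>norm (x - y)\<close>, so the horizontal parts use them up and leave no room for a change of
  height.\<close>

lemma H_between:
  assumes xy: "norm (x - y) = norm x + norm y" "norm (x + y) = norm x + norm y" and \<beta>: "norm (x + y, \<beta>) \<le> 1"
    and H: "H (x, \<beta>) = (x, \<beta>)" "H (y, \<beta>) = (y, \<beta>)"
  obtains z where "H (x + y, \<beta>) = (z, \<beta>)" "norm (z - x) = norm y" "norm (z - y) = norm x"
proof -
  obtain z \<gamma> where z: "H (x + y, \<beta>) = (z, \<gamma>)" by fastforce
  have "(norm x)\<^sup>2 \<le> (norm (x + y))\<^sup>2" "(norm y)\<^sup>2 \<le> (norm (x + y))\<^sup>2"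
    by (rule power_mono; simp add: xy)+
  then have n: "norm (x, \<beta>) \<le> 1" "norm (y, \<beta>) \<le> 1"
    using \<beta> unfolding norm_Pair_le_1 by linarith+
  have "norm (z - x, \<gamma> - \<beta>) \<le> norm y" "norm (z - y, \<gamma> - \<beta>) \<le> norm x"
    using H_le[OF \<beta> n(1)] H_le[OF \<beta> n(2)] by (simp_all add: H z)
  then have 1: "(norm (z - x))\<^sup>2 + (\<gamma> - \<beta>)\<^sup>2 \<le> (norm y)\<^sup>2" "(norm (z - y))\<^sup>2 + (\<gamma> - \<beta>)\<^sup>2 \<le> (norm x)\<^sup>2"
    by (simp_all add: norm_Pair real_sqrt_le_iff sqrt_le_D real_le_lsqrt)
  then have "(norm (z - x))\<^sup>2 \<le> (norm y)\<^sup>2" "(norm (z - y))\<^sup>2 \<le> (norm x)\<^sup>2"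
    using zero_le_power2[of "\<gamma> - \<beta>"] by linarith+
  then have "norm (z - x) \<le> norm y" "norm (z - y) \<le> norm x"
    by (auto intro: power2_le_imp_le)
  moreover have "norm x + norm y \<le> norm (z - x) + norm (z - y)"
    using norm_triangle_ineq4[of "z - y" "z - x"] xy(1) by simp
  ultimately have 2: "norm (z - x) = norm y" "norm (z - y) = norm x" by linarith+
  then have "\<gamma> = \<beta>" using 1 by simp
  then show ?thesis using that[of z] z 2 by simp
qed

lemma H_quad:
  assumes ij: "i \<noteq> j" and st: "\<bar>s\<bar> = 1" "\<bar>t\<bar> = 1"
    and ab: "0 \<le> a" "0 \<le> b" and \<beta>: "(a + b)\<^sup>2 + \<beta>\<^sup>2 \<le> 1"
  obtains d where "0 \<le> d" "d \<le> a" "d \<le> b" "H (quad i s j t a b, \<beta>) = (quad i s j t (a - d) (b - d), \<beta>)"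
proof -
  note nq = norm_quad[OF ij st]
  let ?x = "quad i s j t a 0" and ?y = "quad i s j t 0 b"
  have sum: "?x + ?y = quad i s j t a b" by (simp add: quad_def)
  have "a\<^sup>2 \<le> (a + b)\<^sup>2" "b\<^sup>2 \<le> (a + b)\<^sup>2" using ab by (auto intro: power_mono)
  then have "a\<^sup>2 + \<beta>\<^sup>2 \<le> 1" "b\<^sup>2 + \<beta>\<^sup>2 \<le> 1" using \<beta> by linarith+
  moreover have "(a * s)\<^sup>2 = a\<^sup>2" "(b * t)\<^sup>2 = b\<^sup>2"
    using st by (simp_all add: power_mult_distrib abs_square_eq_1[symmetric])
  ultimately have axes: "H (?x, \<beta>) = (?x, \<beta>)" "H (?y, \<beta>) = (?y, \<beta>)"
    using F_J_axis[of "a * s" \<beta> i] F_J_axis[of "b * t" \<beta> j]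
    by (simp_all add: H_def quad_def)
  obtain z where z: "H (?x + ?y, \<beta>) = (z, \<beta>)" "norm (z - ?x) = norm ?y" "norm (z - ?y) = norm ?x"
  proof (rule H_between[OF _ _ _ axes])
    show "norm (?x - ?y) = norm ?x + norm ?y" by (simp add: quad_diff nq)
    show "norm (?x + ?y) = norm ?x + norm ?y" using ab by (simp add: sum nq)
    show "norm (?x + ?y, \<beta>) \<le> 1" using \<beta> ab by (simp add: sum norm_Pair_le_1 nq)
  qed
  have "norm (?x - z) + norm (z - ?y) \<le> norm (?x - ?y)"
    using z(2,3) ab by (simp add: quad_diff nq norm_minus_commute)
  from ell1_between[OF this]
  have box: "\<bar>seq ?x k - seq z k\<bar> + \<bar>seq z k - seq ?y k\<bar> = \<bar>seq ?x k - seq ?y k\<bar>" for k .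
  obtain p q where pq: "z = quad i s j t p q" "0 \<le> p" "p \<le> a" "0 \<le> q" "q \<le> b"
  proof (rule ell1_between_quad[OF ij st _ _ _ ab])
    show "seq z k = 0" if "k \<noteq> i" "k \<noteq> j" for k using box[of k] that ij by (simp add: seq_quad)
    show "\<bar>a * s - seq z i\<bar> + \<bar>seq z i\<bar> = \<bar>a\<bar>" using box[of i] ij st by (simp add: seq_quad abs_mult)
    show "\<bar>b * t - seq z j\<bar> + \<bar>seq z j\<bar> = \<bar>b\<bar>"
      using box[of j] ij st by (simp add: seq_quad abs_mult norm_minus_commute abs_minus_commute)
  qed
  \<comment> \<open>The distance from \<open>z\<close> to \<open>?x\<close> is
    \<open>(a - p) + q\<close>, and it equals \<open>norm ?y\<close>, which is
    \<open>b\<close>.\<close>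
  have "a - p = b - q" using z(2) pq ab by (simp add: quad_diff nq)
  then have d: "a - p \<le> b" "b - (a - p) = q" using pq by simp_all
  show ?thesis using that[of "a - p"] z(1) pq d by (simp add: sum)
qed

text \<open>By \<open>H_quad\<close> the height is kept and both parameters drop by the same
  \<open>d\<close>; equal norms force \<open>d = 0\<close>.\<close>

lemma H_quad_norm_preserved:
  assumes ij: "i \<noteq> j" and st: "\<bar>s\<bar> = 1" "\<bar>t\<bar> = 1"
    and ab: "0 \<le> a" "0 \<le> b" "0 \<le> a'" "0 \<le> b'" and \<beta>: "(a + b)\<^sup>2 + \<beta>\<^sup>2 \<le> 1"
    and H: "H (quad i s j t a b, \<beta>) = (quad i s j t a' b', \<beta>')" and eq: "(a + b)\<^sup>2 + \<beta>\<^sup>2 = (a' + b')\<^sup>2 + \<beta>'\<^sup>2"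
  shows "a = a' \<and> b = b' \<and> \<beta> = \<beta>'"
proof -
  obtain d where d: "H (quad i s j t a b, \<beta>) = (quad i s j t (a - d) (b - d), \<beta>)"
    using H_quad[OF ij st ab(1,2) \<beta>] by metis
  then have *: "a' = a - d" "b' = b - d" "\<beta>' = \<beta>"
    using H by (auto simp: quad_eq_iff[OF ij st])
  then have "(a + b)\<^sup>2 = (a' + b')\<^sup>2" using eq by simp
  then have "a + b = a' + b'" using ab by (simp add: power2_eq_iff_nonneg)
  then show ?thesis using * by simp
qed

section \<open>Covering a neighbourhood of 0 in a quadrant\<close>

text \<open>Along a line in the direction of \<open>quad i s j t 1 1\<close>, \<^const>\<open>H\<close> starts at a fixed axis point and
  moves continuously, so it covers an initial segment of the line.\<close>

lemma H_quad_surj_aux: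
  assumes ij: "i \<noteq> j" and st: "\<bar>s\<bar> = 1" "\<bar>t\<bar> = 1"
    and m: "H (quad i s j t (1/4) (1/4), 0) = (quad i s j t m m, 0)" "m \<le> 1/4"
    and ab: "0 \<le> b" "b \<le> a" and \<beta>: "a + \<bar>\<beta>\<bar> \<le> m / 2"
  shows "\<exists>p q. 0 \<le> p \<and> 0 \<le> q \<and> (p + q)\<^sup>2 + \<beta>\<^sup>2 \<le> 1 \<and> H (quad i s j t p q, \<beta>) = (quad i s j t a b, \<beta>)"
proof -
  note nq = norm_quad[OF ij st]
  \<comment> \<open>The difference of the two parameters is invariant under \<open>H\<close>, so the
    line \<open>P\<close> with difference \<open>c\<close> is mapped into itself and
    \<open>g\<close> describes the motion along it.\<close>
  define c where "c = a - b"
  have c: "0 \<le> c" "c \<le> a" using ab by (simp_all add: c_def)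
  define P where "P = (\<lambda>u. (quad i s j t (c + u) u, \<beta>))"
  define g where "g = (\<lambda>u. t * seq (fst (H (P u))) j)"
  have ball: "(c + u + u)\<^sup>2 + \<beta>\<^sup>2 \<le> 1" if "0 \<le> u" "u \<le> 1/4" for u
  proof -
    have "(c + u + u)\<^sup>2 \<le> (5/8)\<^sup>2" using that c m(2) \<beta> by (intro power_mono) auto
    moreover have "\<bar>\<beta>\<bar>\<^sup>2 \<le> (1/8)\<^sup>2" using c m(2) \<beta> by (intro power_mono) auto
    ultimately show ?thesis by (simp add: power2_eq_square)
  qed
  have P: "norm (P u) \<le> 1" if "0 \<le> u" "u \<le> 1/4" for u
    using ball[OF that] that c by (simp add: P_def norm_Pair_le_1 nq)
  have HP: "H (P u) = (quad i s j t (c + g u) (g u), \<beta>)" and g_le: "0 \<le> g u" "g u \<le> u"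
    if u: "0 \<le> u" "u \<le> 1/4" for u
  proof -
    obtain d where d: "0 \<le> d" "d \<le> u" "H (P u) = (quad i s j t (c + u - d) (u - d), \<beta>)"
      using H_quad[OF ij st _ _ ball[OF u]] u c unfolding P_def by (metis add_nonneg_nonneg)
    then have "g u = u - d" by (simp add: g_def seq_quad_snd[OF ij st(2)])
    then show "H (P u) = (quad i s j t (c + g u) (g u), \<beta>)" "0 \<le> g u" "g u \<le> u"
      using d by (simp_all add: add_diff_eq)
  qed
  have coord: "\<bar>t * seq (fst x) j - t * seq (fst y) j\<bar> \<le> norm (x - y)" for x y :: ell1_sum2_real
  proof -
    have "\<bar>t * seq (fst x) j - t * seq (fst y) j\<bar> = \<bar>seq (fst (x - y)) j\<bar>"
      using st by (simp add: abs_mult flip: right_diff_distrib)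
    also have "\<dots> \<le> norm (fst (x - y))" by (rule abs_seq_le_norm)
    also have "\<dots> \<le> norm (x - y)" by (metis norm_fst_le prod.collapse)
    finally show ?thesis .
  qed
  have "2-lipschitz_on {0..1/4} g"
  proof (rule lipschitz_onI)
    fix u v :: real assume uv: "u \<in> {0..1/4}" "v \<in> {0..1/4}"
    have "\<bar>g u - g v\<bar> \<le> norm (H (P u) - H (P v))" unfolding g_def by (rule coord)
    also have "\<dots> \<le> norm (P u - P v)" using uv by (intro H_le P) auto
    also have "\<dots> = 2 * \<bar>u - v\<bar>" by (simp add: P_def quad_diff norm_Pair nq real_sqrt_mult)
    finally show "dist (g u) (g v) \<le> 2 * dist u v" by (simp add: dist_real_def)
  qed simp
  then have cont: "continuous_on {0..1/4} g" by (rule lipschitz_on_continuous_on)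
  \<comment> \<open>The end of the line is within \<open>c + \<bar>\<beta>\<bar>\<close> of the
    reference point, whose image has parameter \<open>m\<close>. Hence \<open>g (1/4)\<close> is at
    least \<open>m - c - \<bar>\<beta>\<bar>\<close>, which is at least \<open>b\<close>.\<close>
  have "\<bar>g (1/4) - m\<bar> \<le> norm (H (P (1/4)) - H (quad i s j t (1/4) (1/4), 0))"
    using coord[of "H (P (1/4))" "H (quad i s j t (1/4) (1/4), 0)"]
    by (simp add: g_def m(1) seq_quad_snd[OF ij st(2)])
  also have "\<dots> \<le> norm (P (1/4) - (quad i s j t (1/4) (1/4), 0))"
    by (intro H_le P) (simp_all add: norm_Pair nq)
  also have "\<dots> = norm (quad i s j t c 0, \<beta>)" by (simp add: P_def quad_diff)
  also have "\<dots> \<le> c + \<bar>\<beta>\<bar>"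
    using norm_Pair_le[of "quad i s j t c 0" \<beta>] c by (simp add: nq)
  finally have "b \<le> g (1/4)" using \<beta> ab c by (simp add: c_def)
  moreover have "g 0 \<le> b" using g_le(2)[of 0] ab by simp
  ultimately obtain u where u: "0 \<le> u" "u \<le> 1/4" "g u = b"
    using IVT'[of g 0 b "1/4"] cont by auto
  then have "H (quad i s j t (c + u) u, \<beta>) = (quad i s j t a b, \<beta>)"
    using HP[of u] by (simp add: P_def c_def)
  then show ?thesis using ball[of u] u c by (intro exI[of _ "c + u"] exI[of _ u]) auto
qed

text \<open>The diagonal point with parameters \<open>1/4\<close> goes to a diagonal point with some
  parameter \<open>m\<close>, nonzero because \<open>H\<close> is injective and fixes 0. The case
  \<open>a < b\<close> follows by swapping the coordinates.\<close>

lemma H_quad_surj: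
  assumes ij: "i \<noteq> j" and st: "\<bar>s\<bar> = 1" "\<bar>t\<bar> = 1"
  obtains m where "0 < m" "m \<le> 1/4"
    "\<forall>a b \<beta>. 0 \<le> a \<longrightarrow> 0 \<le> b \<longrightarrow> a + \<bar>\<beta>\<bar> \<le> m / 2 \<longrightarrow> b + \<bar>\<beta>\<bar> \<le> m / 2 \<longrightarrow>
      (\<exists>p q. 0 \<le> p \<and> 0 \<le> q \<and> (p + q)\<^sup>2 + \<beta>\<^sup>2 \<le> 1 \<and> H (quad i s j t p q, \<beta>) = (quad i s j t a b, \<beta>))"
proof -
  note nq = norm_quad[OF ij st]
  obtain d where d: "0 \<le> d" "d \<le> 1/4" "H (quad i s j t (1/4) (1/4), 0) = (quad i s j t (1/4 - d) (1/4 - d), 0)"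
    using H_quad[OF ij st, of "1/4" "1/4" 0] by (auto simp: power2_eq_square)
  define m where "m = 1/4 - d"
  have m: "H (quad i s j t (1/4) (1/4), 0) = (quad i s j t m m, 0)" "m \<le> 1/4" using d by (simp_all add: m_def)
  then have m': "H (quad j t i s (1/4) (1/4), 0) = (quad j t i s m m, 0)" by (simp add: quad_swap)
  have "m \<noteq> 0"
  proof
    assume "m = 0"
    then have "H (quad i s j t (1/4) (1/4), 0) = H 0" by (simp add: m(1) quad_0 H_0 flip: zero_prod_def)
    moreover have "norm (quad i s j t (1/4) (1/4), 0::real) \<le> 1" by (simp add: norm_Pair nq)
    ultimately have "(quad i s j t (1/4) (1/4), 0::real) = 0"
      using H_inj[of "(quad i s j t (1/4) (1/4), 0)" 0] by simp
    then have "norm (quad i s j t (1/4) (1/4)) = 0" by (simp add: zero_prod_def)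
    then show False by (simp add: nq)
  qed
  show ?thesis
  proof
    show "0 < m" "m \<le> 1/4" using \<open>m \<noteq> 0\<close> d by (auto simp: m_def)
    have "\<exists>p q. 0 \<le> p \<and> 0 \<le> q \<and> (p + q)\<^sup>2 + \<beta>\<^sup>2 \<le> 1 \<and> H (quad i s j t p q, \<beta>) = (quad i s j t a b, \<beta>)"
      if *: "0 \<le> a" "0 \<le> b" "a + \<bar>\<beta>\<bar> \<le> m / 2" "b + \<bar>\<beta>\<bar> \<le> m / 2" for a b \<beta>
    proof (cases "b \<le> a")
      case True
      then show ?thesis using H_quad_surj_aux[OF ij st m] * by blast
    next
      case False
      then show ?thesis
        using H_quad_surj_aux[OF ij[symmetric] st(2,1) m' m(2), of a b \<beta>] *
        unfolding quad_swap[of j t i s] by (metis add.commute linear)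
    qed
    then show "\<forall>a b \<beta>. 0 \<le> a \<longrightarrow> 0 \<le> b \<longrightarrow> a + \<bar>\<beta>\<bar> \<le> m / 2 \<longrightarrow> b + \<bar>\<beta>\<bar> \<le> m / 2 \<longrightarrow>
      (\<exists>p q. 0 \<le> p \<and> 0 \<le> q \<and> (p + q)\<^sup>2 + \<beta>\<^sup>2 \<le> 1 \<and> H (quad i s j t p q, \<beta>) = (quad i s j t a b, \<beta>))" by blast
  qed
qed

text \<open>For \<open>x\<close> the preimage of the given point, \<open>F (\<tau> x)\<close> lies
  metrically between 0 and that point, hence in the quadrant. For small \<open>\<tau>\<close> it is
  also an \<open>H\<close>-image from the quadrant, so injectivity of \<open>F\<close> puts
  \<open>\<tau> x\<close>, and by scaling \<open>x\<close>, in the range of \<open>J\<close>.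
  Equality of norms then finishes the proof.\<close>

lemma H_quad_sphere:
  assumes ij: "i \<noteq> j" and st: "\<bar>s\<bar> = 1" "\<bar>t\<bar> = 1"
    and ab: "0 \<le> a" "0 \<le> b" and \<beta>: "(a + b)\<^sup>2 + \<beta>\<^sup>2 = 1"
  shows "H (quad i s j t a b, \<beta>) = (quad i s j t a b, \<beta>)"
proof -
  note nq = norm_quad[OF ij st]
  let ?q = "quad i s j t a b"
  obtain m where m: "0 < m" "m \<le> 1/4" and surj: "\<forall>a b \<beta>. 0 \<le> a \<longrightarrow> 0 \<le> b \<longrightarrow> a + \<bar>\<beta>\<bar> \<le> m / 2 \<longrightarrow> b + \<bar>\<beta>\<bar> \<le> m / 2 \<longrightarrow>
      (\<exists>p q. 0 \<le> p \<and> 0 \<le> q \<and> (p + q)\<^sup>2 + \<beta>\<^sup>2 \<le> 1 \<and> H (quad i s j t p q, \<beta>) = (quad i s j t a b, \<beta>))"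
    by (rule H_quad_surj[OF ij st])
  \<comment> \<open>With this choice \<open>p + \<bar>\<gamma>\<bar>\<close> and
    \<open>q + \<bar>\<gamma>\<bar>\<close> are at most \<open>2 * \<tau> = m / 2\<close>, as
    \<open>surj\<close> requires.\<close>
  define \<tau> where "\<tau> = m / 4"
  have \<tau>: "0 < \<tau>" "\<tau> \<le> 1" using m by (simp_all add: \<tau>_def)
  have y: "norm (?q, \<beta>) = 1" using \<beta> ab by (simp add: norm_Pair_eq_1 nq)
  define x where "x = G (?q, \<beta>)"
  have x: "norm x = 1" "F x = (?q, \<beta>)" using y by (simp_all add: x_def norm_G_sphere F_G)
  obtain z \<gamma> where z: "F (\<tau> *\<^sub>R x) = (z, \<gamma>)" by fastforce
  have z1: "norm (z, \<gamma>) \<le> \<tau>" using norm_F_le[of "\<tau> *\<^sub>R x"] \<tau> x by (simp add: z)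
  have "norm (x - \<tau> *\<^sub>R x) = norm ((1 - \<tau>) *\<^sub>R x)" by (simp add: algebra_simps)
  then have z2: "norm (?q - z, \<beta> - \<gamma>) \<le> 1 - \<tau>"
    using F_le[of x "\<tau> *\<^sub>R x"] \<tau> x by (simp add: z)
  \<comment> \<open>The triangle inequality in the Euclidean plane of horizontal norms and heights
    turns betweenness in the 2-sum into betweenness of the horizontal parts.\<close>
  have "norm (norm z + norm (?q - z), \<beta>) \<le> norm (norm z, \<gamma>) + norm (norm (?q - z), \<beta> - \<gamma>)"
    using norm_triangle_ineq[of "(norm z, \<gamma>)" "(norm (?q - z), \<beta> - \<gamma>)"] by simp
  also have "\<dots> = norm (z, \<gamma>) + norm (?q - z, \<beta> - \<gamma>)" by (simp add: norm_Pair)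
  also have "\<dots> \<le> 1" using z1 z2 by simp
  finally have "(norm z + norm (?q - z))\<^sup>2 + \<beta>\<^sup>2 \<le> 1" by (simp add: norm_Pair)
  then have "(norm z + norm (?q - z))\<^sup>2 \<le> (a + b)\<^sup>2" using \<beta> by linarith
  then have "norm z + norm (?q - z) \<le> a + b" by (rule power2_le_imp_le) (use ab in simp)
  then have "norm (?q - z) + norm (z - 0) \<le> norm (?q - 0)" using ab by (simp add: nq)
  from ell1_between[OF this]
  have box: "\<bar>seq ?q k - seq z k\<bar> + \<bar>seq z k\<bar> = \<bar>seq ?q k\<bar>" for k by simp
  obtain p q where pq: "z = quad i s j t p q" "0 \<le> p" "0 \<le> q"
  proof (rule ell1_between_quad[OF ij st _ _ _ ab])
    show "seq z k = 0" if "k \<noteq> i" "k \<noteq> j" for k using box[of k] that ij by (simp add: seq_quad)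
    show "\<bar>a * s - seq z i\<bar> + \<bar>seq z i\<bar> = \<bar>a\<bar>" using box[of i] ij st by (simp add: seq_quad abs_mult)
    show "\<bar>b * t - seq z j\<bar> + \<bar>seq z j\<bar> = \<bar>b\<bar>" using box[of j] ij st by (simp add: seq_quad abs_mult)
  qed
  have small: "p + q \<le> \<tau>" "\<bar>\<gamma>\<bar> \<le> \<tau>"
    using norm_fst_le[of z \<gamma>] norm_snd_le[of \<gamma> z] z1 pq by (simp_all add: nq)
  have "1 - \<tau> \<ge> 1 - norm (z, \<gamma>)"
    using norm_triangle_ineq2[of "(?q, \<beta>)" "(z, \<gamma>)"] z2 y by simp
  then have n: "norm (z, \<gamma>) = \<tau>" using z1 by simp
  then have n2: "(p + q)\<^sup>2 + \<gamma>\<^sup>2 = \<tau>\<^sup>2" using pq by (auto simp: norm_Pair nq)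
  obtain p' q' where pq': "0 \<le> p'" "0 \<le> q'" "(p' + q')\<^sup>2 + \<gamma>\<^sup>2 \<le> 1"
    "H (quad i s j t p' q', \<gamma>) = (quad i s j t p q, \<gamma>)"
    using surj[rule_format, OF pq(2,3), of \<gamma>] small pq by (auto simp: \<tau>_def)
  then have "F (J (quad i s j t p' q', \<gamma>)) = F (\<tau> *\<^sub>R x)" using z by (simp add: H_def pq(1))
  moreover have "norm (quad i s j t p' q', \<gamma>) \<le> 1" using pq' by (simp add: norm_Pair_le_1 nq)
  ultimately have Jx: "J (quad i s j t p' q', \<gamma>) = \<tau> *\<^sub>R x"
    using \<tau> x by (auto intro: F_inj simp: norm_J)
  then have "norm (quad i s j t p' q', \<gamma>) = \<tau>" using x \<tau> norm_J[of "(quad i s j t p' q', \<gamma>)"] by simp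
  then have "(p' + q')\<^sup>2 + \<gamma>\<^sup>2 = \<tau>\<^sup>2" using pq' by (auto simp: norm_Pair nq)
  \<comment> \<open>Both the point and its image under \<open>H\<close> have norm
    \<open>\<tau>\<close>.\<close>
  then have "p' = p \<and> q' = q"
    using H_quad_norm_preserved[OF ij st pq'(1,2) pq(2,3) pq'(3,4)] n2 by simp
  then have "J ((1 / \<tau>) *\<^sub>R (quad i s j t p q, \<gamma>)) = x" using Jx \<tau> by (simp add: J_scaleR del: scaleR_Pair)
  then have H: "H (quad i s j t (p / \<tau>) (q / \<tau>), \<gamma> / \<tau>) = (?q, \<beta>)" using x(2) by (simp add: H_def scaleR_quad)
  have eq: "(p / \<tau> + q / \<tau>)\<^sup>2 + (\<gamma> / \<tau>)\<^sup>2 = 1"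
    using n2 \<tau> by (simp add: power_divide flip: add_divide_distrib)
  have "p / \<tau> = a \<and> q / \<tau> = b \<and> \<gamma> / \<tau> = \<beta>"
    by (rule H_quad_norm_preserved[OF ij st _ _ ab _ H]) (use eq \<beta> pq \<tau> in auto)
  then show ?thesis using H by simp
qed

text \<open>Raising both parameters by \<open>r\<close> at the same height reaches the sphere, where
  \<open>H\<close> is the identity. If \<open>H\<close> lowers the original parameters by
  \<open>d\<close>, the distance \<open>2 * r\<close> becomes \<open>2 * (r + d)\<close>, so
  \<open>d = 0\<close>.\<close>

lemma H_quad_id:
  assumes ij: "i \<noteq> j" and st: "\<bar>s\<bar> = 1" "\<bar>t\<bar> = 1"
    and ab: "0 \<le> a" "0 \<le> b" and \<beta>: "(a + b)\<^sup>2 + \<beta>\<^sup>2 \<le> 1"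
  shows "H (quad i s j t a b, \<beta>) = (quad i s j t a b, \<beta>)"
proof -
  note nq = norm_quad[OF ij st]
  define r where "r = (sqrt (1 - \<beta>\<^sup>2) - a - b) / 2"
  have "a + b \<le> sqrt (1 - \<beta>\<^sup>2)" using \<beta> by (intro real_le_rsqrt) simp
  then have r: "0 \<le> r" by (simp add: r_def)
  have "a + r + (b + r) = sqrt (1 - \<beta>\<^sup>2)" by (simp add: r_def field_simps)
  moreover have "0 \<le> 1 - \<beta>\<^sup>2" using \<beta> zero_le_power2[of "a + b"] by linarith
  ultimately have q: "(a + r + (b + r))\<^sup>2 + \<beta>\<^sup>2 = 1" by simp
  have Hq: "H (quad i s j t (a + r) (b + r), \<beta>) = (quad i s j t (a + r) (b + r), \<beta>)"
    by (rule H_quad_sphere[OF ij st _ _ q]) (use ab r in auto)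
  obtain d where d: "0 \<le> d" "H (quad i s j t a b, \<beta>) = (quad i s j t (a - d) (b - d), \<beta>)"
    using H_quad[OF ij st ab \<beta>] by metis
  have "norm (H (quad i s j t (a + r) (b + r), \<beta>) - H (quad i s j t a b, \<beta>))
      \<le> norm ((quad i s j t (a + r) (b + r), \<beta>) - (quad i s j t a b, \<beta>))"
    by (rule H_le) (use q \<beta> ab r in \<open>simp_all add: norm_Pair_le_1 nq\<close>)
  then have "d = 0" using d r by (simp add: Hq quad_diff norm_Pair nq real_sqrt_mult)
  then show ?thesis using d by simp
qed

text \<open>Induction on the size of the support, with \<open>H_quad_id\<close> for at most two
  indices. Otherwise, splitting off any coordinate of the support shows that it carries exactly half
  of \<open>norm (x - z)\<close>; three such coordinates leave only \<open>x = z\<close>.\<close>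

lemma H_finite_support:
  assumes "finite {k. seq x k \<noteq> 0}" "norm (x, \<beta>) \<le> 1"
  shows "H (x, \<beta>) = (x, \<beta>)"
  using assms
proof (induction "card {k. seq x k \<noteq> 0}" arbitrary: x rule: less_induct)
  case less
  let ?S = "{k. seq x k \<noteq> 0}"
  have axis: "H (seq x n *\<^sub>R unit n, \<beta>) = (seq x n *\<^sub>R unit n, \<beta>)" for n
  proof -
    have "\<bar>seq x n\<bar>\<^sup>2 \<le> (norm x)\<^sup>2" by (intro power_mono abs_seq_le_norm) simp
    then show ?thesis using F_J_axis[of "seq x n" \<beta> n] less.prems(2) by (simp add: H_def norm_Pair_le_1)
  qed
  show ?case
  proof (cases "\<exists>i j. ?S \<subseteq> {i, j}")
    case True
    \<comment> \<open>A support with fewer than two indices is enlarged to a pair of distinct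
      indices.\<close>
    then obtain i j where ij: "i \<noteq> j" "?S \<subseteq> {i, j}"
      by (metis insert_absorb2 insert_iff n_not_Suc_n subset_insertI2 subset_iff)
    define s t where "s = (if seq x i < 0 then - 1 else 1 :: real)" "t = (if seq x j < 0 then - 1 else 1 :: real)"
    have x: "x = quad i s j t \<bar>seq x i\<bar> \<bar>seq x j\<bar>"
      by (rule ell1_eqI) (use ij in \<open>auto simp: seq_quad s_t_def\<close>)
    have st: "\<bar>s\<bar> = 1" "\<bar>t\<bar> = 1" by (simp_all add: s_t_def)
    have "norm x = \<bar>seq x i\<bar> + \<bar>seq x j\<bar>" by (subst x) (simp add: norm_quad ij st)
    then have "(\<bar>seq x i\<bar> + \<bar>seq x j\<bar>)\<^sup>2 + \<beta>\<^sup>2 \<le> 1" using less.prems(2) by (simp add: norm_Pair_le_1)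
    from H_quad_id[OF ij(1) st _ _ this] show ?thesis unfolding x[symmetric] by simp
  next
    case False
    then obtain i j k where ijk: "i \<in> ?S" "j \<in> ?S" "k \<in> ?S" "i \<noteq> j" "i \<noteq> k" "j \<noteq> k"
      by (metis (no_types, lifting) insertCI subsetI)
    obtain z \<gamma> where z: "H (x, \<beta>) = (z, \<gamma>)" by fastforce
    have key: "norm (x - z) = 2 * \<bar>seq (x - z) n\<bar> \<and> \<gamma> = \<beta>" if n: "n \<in> ?S" for n
    proof -
      let ?e = "seq x n *\<^sub>R unit n"
      let ?y = "x - ?e"
      have eq: "{k. seq ?y k \<noteq> 0} = ?S - {n}" by auto
      have sup: "finite {k. seq ?y k \<noteq> 0}" "card {k. seq ?y k \<noteq> 0} < card ?S"
        unfolding eq using less.prems(1) card_Diff1_less[OF less.prems(1) n] by simp_all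
      have ny: "norm x = norm ?e + norm ?y" using norm_split[of x n] by simp
      have "(norm ?y)\<^sup>2 \<le> (norm x)\<^sup>2" by (rule power_mono) (simp_all add: ny)
      then have "norm (?y, \<beta>) \<le> 1" using less.prems(2) unfolding norm_Pair_le_1 by linarith
      then have Hy: "H (?y, \<beta>) = (?y, \<beta>)" by (rule less.hyps[OF sup(2,1)])
      have "norm (?e - ?y) = norm ?e + norm ?y"
        unfolding diff_conv_add_uminus[of ?e ?y] norm_add_unit by (simp add: norm_minus_commute)
      moreover have "?e + ?y = x" by simp
      ultimately obtain z' where z': "H (x, \<beta>) = (z', \<beta>)" "norm (z' - ?e) = norm ?y" "norm (z' - ?y) = norm ?e"
        using H_between[OF _ _ _ axis Hy] ny less.prems(2) by metis
      then have zz: "z' = z" "\<gamma> = \<beta>" using z by simp_all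
      have "norm (?e - z) + norm (z - ?y) \<le> norm (?e - ?y)"
        using z'(2,3) \<open>norm (?e - ?y) = norm ?e + norm ?y\<close> by (simp add: zz norm_minus_commute)
      \<comment> \<open>Coordinate \<open>n\<close> of \<open>z\<close> lies between 0 and that of
        \<open>x\<close>. As \<open>?y - z\<close> has norm \<open>\<bar>seq x n\<bar>\<close>, its
        part off \<open>n\<close>, shared with \<open>x - z\<close>, has norm
        \<open>\<bar>seq x n - seq z n\<bar>\<close>.\<close>
      from ell1_between[OF this, of n] have "\<bar>seq x n - seq z n\<bar> + \<bar>seq z n\<bar> = \<bar>seq x n\<bar>" by simp
      moreover have "norm (?y - z) = \<bar>seq x n\<bar>" using z'(3) by (simp add: zz norm_minus_commute)
      moreover have "norm (?y - z) = \<bar>seq z n\<bar> + norm (x - z - seq (x - z) n *\<^sub>R unit n)"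
        using norm_split[of "?y - z" n] by (simp add: algebra_simps)
      ultimately show ?thesis using norm_split[of "x - z" n] zz by simp
    qed
    have "norm w \<ge> \<bar>seq w i\<bar> + \<bar>seq w j\<bar> + \<bar>seq w k\<bar>" for w
      using norm_split[of w i] norm_split[of "w - seq w i *\<^sub>R unit i" j] ijk
        abs_seq_le_norm[of "w - seq w i *\<^sub>R unit i - seq w j *\<^sub>R unit j" k] by simp
    from this[of "x - z"] have "norm (x - z) \<le> 0"
      using key[OF ijk(1)] key[OF ijk(2)] key[OF ijk(3)] by linarith
    then show ?thesis using z key[OF ijk(1)] by simp
  qed
qed

text \<open>Truncations have finite support, stay in the ball and approximate \<open>x\<close>;
  non-expansiveness carries the identity over to the limit.\<close>

lemma H_id:
  assumes z: "norm z \<le> 1" shows "H z = z"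
proof -
  obtain x \<beta> where x: "z = (x, \<beta>)" by (cases z)
  have "norm (H z - z) \<le> 0 + e" if e: "e > 0" for e
  proof -
    obtain y A where y: "finite A" "\<And>i. i \<notin> A \<Longrightarrow> seq y i = 0" "norm (x - y) < e / 2" "norm y \<le> norm x"
      using ell1_truncate[of "e / 2" x] e by (metis half_gt_zero)
    have "{k. seq y k \<noteq> 0} \<subseteq> A" using y(2) by auto
    then have f: "finite {k. seq y k \<noteq> 0}" using y(1) by (rule finite_subset)
    have "(norm y)\<^sup>2 \<le> (norm x)\<^sup>2" using y(4) by (rule power_mono) simp
    then have n: "norm (y, \<beta>) \<le> 1" using z unfolding x norm_Pair_le_1 by linarith
    have "norm (H z - (y, \<beta>)) \<le> norm (z - (y, \<beta>))"
      using H_le[OF z n] H_finite_support[OF f n] by simp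
    moreover have "norm (z - (y, \<beta>)) < e / 2" using y(3) by (simp add: x norm_Pair)
    moreover have "norm (H z - z) \<le> norm (H z - (y, \<beta>)) + norm (z - (y, \<beta>))"
      using norm_triangle_ineq4[of "H z - (y, \<beta>)" "z - (y, \<beta>)"] by simp
    ultimately show ?thesis by linarith
  qed
  then have "norm (H z - z) \<le> 0" by (rule field_le_epsilon)
  then show ?thesis by simp
qed

text \<open>\<open>F (J (F u)) = F u\<close> and injectivity give \<open>J (F u) = u\<close>, so the
  distances preserved by \<open>J\<close> are those preserved by \<open>F\<close>.\<close>

lemma isometry: "isometry_on (cball 0 1) F"
proof -
  have JF: "J (F u) = u" if "norm u \<le> 1" for u
    using F_inj[of "J (F u)" u] H_id[OF norm_F_le_1[OF that]] that
    by (simp add: H_def norm_J norm_F_le_1)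
  have "norm (u - v) = norm (F u - F v)" if "norm u \<le> 1" "norm v \<le> 1" for u v
    using norm_J[of "F u - F v"] by (simp add: J_diff JF that)
  then show ?thesis by (simp add: isometry_on_def dist_norm)
qed

end

theorem theorem3p1:
  shows "plastic (cball (0 :: ell1_sum2_real) 1)"
  unfolding plastic_def
proof (intro allI impI)
  fix F :: "ell1_sum2_real \<Rightarrow> ell1_sum2_real"
  assume "bij_betw F (cball 0 1) (cball 0 1) \<and> nonexpansive_on (cball 0 1) F"
  then interpret ell1_ball_bijection F by unfold_locales auto
  obtain \<sigma> \<epsilon> s where \<sigma>: "inj \<sigma>" and \<epsilon>: "\<forall>n. \<bar>\<epsilon> n\<bar> = 1" and s: "\<bar>s\<bar> = 1"
    and F: "\<forall>n a b. a\<^sup>2 + b\<^sup>2 \<le> 1 \<longrightarrow> F (a *\<^sub>R \<epsilon> n *\<^sub>R unit (\<sigma> n), b * s) = (a *\<^sub>R unit n, b)"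
    by (rule G_axes)
  obtain J where J: "\<forall>x y. J (x - y) = J x - J y" "\<forall>r x. J (r *\<^sub>R x) = r *\<^sub>R J x"
    "\<forall>x. norm (J x) = norm x" "\<forall>n. J (unit n) = \<epsilon> n *\<^sub>R unit (\<sigma> n)"
    by (rule ell1_signed_embedding[OF \<sigma> \<epsilon>])
  \<comment> \<open>The embedding of the sequence space is extended to the 2-sum by the sign
    \<open>s\<close> with which \<open>G\<close> acts on the pole.\<close>
  interpret normalized_ell1_ball_bijection F "\<lambda>z. (J (fst z), snd z * s)"
  proof
    fix x y z :: ell1_sum2_real and r a b :: real and n
    show "(J (fst (x - y)), snd (x - y) * s) = (J (fst x), snd x * s) - (J (fst y), snd y * s)"
      using J(1) by (simp add: left_diff_distrib)
    show "(J (fst (r *\<^sub>R x)), snd (r *\<^sub>R x) * s) = r *\<^sub>R (J (fst x), snd x * s)"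
      using J(2) by simp
    show "norm (J (fst x), snd x * s) = norm x"
      using J(3) s by (simp add: norm_prod_def abs_mult)
    show "F (J (fst (a *\<^sub>R unit n, b)), snd (a *\<^sub>R unit n, b) * s) = (a *\<^sub>R unit n, b)" if "a\<^sup>2 + b\<^sup>2 \<le> 1"
      using F that J(2,4) by simp
  qed
  show "isometry_on (cball 0 1) F" by (rule isometry)
qed

end
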